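(* Let $F(x,y)=F(y,x)\in\mathbb{Q}[x,y]$ be a symmetric polynomial of total degree $r$, and let $d=\deg_x F(x,y)$. There are polynomials $c_{F,k}(x)\in\mathbb{Q}[x]$ ($0\le k\le\lfloor r/2\rfloor$), depending only on $k$ and $F$ and each of degree at most $d$, such that for every integer $n\ge2$, $$\sum_{k=1}^{n-1}F(k,n-k)\,\zeta(2k,2n-2k)=\sum_{k=0}^{\lfloor r/2\rfloor}c_{F,k}(n)\,\zeta(2k)\zeta(2n-2k).$$
   Context: $\zeta$ is the Riemann zeta function, with $\zeta(0)=-1/2$; $\zeta(a,b)=\sum_{m_1>m_2>0}m_1^{-a}m_2^{-b}$ is the double zeta value. *)

theory Defs
  imports "HOL-Analysis.Analysis" "HOL-Computational_Algebra.Polynomial"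
begin

text \<open>
  A polynomial \<open>F \<in> \<rat>[x,y]\<close> is represented as an element of \<open>\<rat>[y][x]\<close>: the coefficient of
  \<open>x\<^sup>i y\<^sup>j\<close> is \<open>coeff (coeff F i) j\<close>. Hence \<open>degree F\<close> is the degree of \<open>F\<close> in \<open>x\<close>.
\<close>

definition eval_xy :: "rat poly poly \<Rightarrow> rat \<Rightarrow> rat \<Rightarrow> rat" where
  "eval_xy F a b = poly (poly F [:a:]) b"

definition symmetric_xy :: "rat poly poly \<Rightarrow> bool" where
  "symmetric_xy F \<longleftrightarrow> (\<forall>i j. coeff (coeff F i) j = coeff (coeff F j) i)"

text \<open>As for \<open>degree\<close>, the zero polynomial gets total degree \<open>0\<close>.\<close>

definition total_degree :: "rat poly poly \<Rightarrow> nat" where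
  "total_degree F = Max (insert 0 {i + j | i j. coeff (coeff F i) j \<noteq> 0})"

text \<open>
  The analytic continuation of the Dirichlet series to \<open>\<complex> - {1}\<close>. By the identity theorem the
  choice is unique there; the value at the pole \<open>1\<close> is left unspecified.
\<close>

definition riemann_zeta :: "complex \<Rightarrow> complex" where
  "riemann_zeta = (SOME f. f holomorphic_on (- {1}) \<and>
     (\<forall>s. Re s > 1 \<longrightarrow> (\<lambda>m. of_nat (Suc m) powr (- s)) sums f s))"

definition double_zeta :: "nat \<Rightarrow> nat \<Rightarrow> complex" where
  "double_zeta a b =
     (\<Sum>\<^sub>\<infinity>(m1, m2) \<in> {(m1 :: nat, m2 :: nat). m1 > m2 \<and> m2 > 0}. 1 / (of_nat m1 ^ a * of_nat m2 ^ b))"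

end

theory Submission
  imports Defs "HOL-Complex_Analysis.Complex_Analysis"
begin

text \<open>
  Symmetry and the relation \<open>\<zeta>(a,b) + \<zeta>(b,a) = \<zeta>(a)\<zeta>(b) - \<zeta>(a+b)\<close> reduce the claim to the sums
  of \<open>k\<^sup>i (n-k)\<^sup>j (\<zeta>(2k)\<zeta>(2n-2k) - \<zeta>(2n))\<close> over \<open>0 < k < n\<close>. The generating function of \<open>\<zeta>(2k)\<close>
  is \<open>-(\<pi>x/2) cot(\<pi>x)\<close>, and the addition theorem of the cotangent, applied to the arguments \<open>\<pi>ax\<close>
  and \<open>\<pi>x\<close>, gives for \<open>n \<noteq> 1\<close> a polynomial identity in \<open>a\<close>, in which \<open>\<zeta>(2l)\<zeta>(2n-2l)\<close> occurs with the
  factor \<open>(1-a)\<^sup>2\<^sup>l\<^sup>-\<^sup>1 (a\<^sup>2\<^sup>n\<^sup>-\<^sup>2\<^sup>l - a)\<close>. The functional \<open>a\<^sup>p \<mapsto> (p/2)\<^sup>i ((2n-p)/2)\<^sup>j\<close> turns the left side into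
  the required sum. On the right it produces polynomials in \<open>n\<close> of degree at most \<open>max i j\<close>, and it kills
  the terms with \<open>2l > i + j\<close>, because these factors vanish at \<open>a = 1\<close> to order \<open>2l\<close>. The terms with \<open>l \<ge> n\<close>
  are accounted for by \<open>\<zeta>(0) = -1/2\<close> and the zeros of \<open>\<zeta>\<close> at the negative even integers.
\<close>

section \<open>Alternating power sums\<close>

lemma alternating_sum_telescope:
  fixes u :: "nat \<Rightarrow> 'a :: comm_ring_1"
  shows "(\<Sum>k\<le>N. (-1) ^ k * (u (Suc k) + u k)) = u 0 + (-1) ^ N * u (Suc N)"
  by (induction N) (auto simp: algebra_simps)

text \<open>Telescope u(k) = k^i (2n+1-k)^j. Expanding (k+1)^i in u(k+1) and ((2n-k)+1)^j in u(k)
  binomially, both contribute the leading term k^i (2n-k)^j, hence the factor 2; all other terms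
  have one exponent lowered. The upper boundary value has sign +1 because 2n is even.\<close>

lemma alternating_power_sum_recurrence:
  fixes i j n :: nat
  defines "S \<equiv> \<lambda>i j. \<Sum>k\<le>2*n. (-1) ^ k * (of_nat k ^ i * of_nat (2*n-k) ^ j) :: rat"
  shows "2 * S i j = 0 ^ j * (2 * of_nat n + 1) ^ i + 0 ^ i * (2 * of_nat n + 1) ^ j
           - (\<Sum>i'<i. of_nat (i choose i') * S i' j) - (\<Sum>j'<j. of_nat (j choose j') * S i j')"
proof -
  define u :: "nat \<Rightarrow> rat" where "u = (\<lambda>k. of_nat k ^ i * of_nat (2*n+1-k) ^ j)"
  have expand: "(of_nat k + 1) ^ m = (of_nat k :: rat) ^ m + (\<Sum>m'<m. of_nat (m choose m') * of_nat k ^ m')"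
    for k m :: nat
    by (subst binomial_ring) (simp add: lessThan_Suc_atMost [symmetric] add.commute)
  have u0: "u k = of_nat k ^ i * (of_nat (2*n-k) ^ j + (\<Sum>j'<j. of_nat (j choose j') * of_nat (2*n-k) ^ j'))"
    if "k \<le> 2*n" for k
  proof -
    have "2*n+1-k = Suc (2*n-k)" using that by simp
    thus ?thesis unfolding u_def expand [symmetric] by (simp add: add.commute)
  qed
  have u1: "u (Suc k) = (of_nat k ^ i + (\<Sum>i'<i. of_nat (i choose i') * of_nat k ^ i')) * of_nat (2*n-k) ^ j" for k
    unfolding u_def expand [symmetric] by (simp add: add.commute)
  have "(\<Sum>k\<le>2*n. (-1) ^ k * (u (Suc k) + u k)) =
      (\<Sum>k\<le>2*n. 2 * ((-1) ^ k * (of_nat k ^ i * of_nat (2*n-k) ^ j))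
         + (\<Sum>i'<i. of_nat (i choose i') * ((-1) ^ k * (of_nat k ^ i' * of_nat (2*n-k) ^ j)))
         + (\<Sum>j'<j. of_nat (j choose j') * ((-1) ^ k * (of_nat k ^ i * of_nat (2*n-k) ^ j'))))"
    by (intro sum.cong refl) (simp add: u0 u1 algebra_simps sum_distrib_left)
  also have "\<dots> = 2 * S i j + (\<Sum>i'<i. of_nat (i choose i') * S i' j) + (\<Sum>j'<j. of_nat (j choose j') * S i j')"
    unfolding S_def sum.distrib sum_distrib_left
    by (intro arg_cong2 [where f = "(+)"] refl; rule sum.swap)
  finally show ?thesis
    unfolding alternating_sum_telescope by (simp add: u_def algebra_simps)
qed

text \<open>Induction on i + j through the recurrence, whose boundary terms have degree at most max
  i j. The alternating signs are essential for this bound: the same sum without them has degree i +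
  j + 1 in n.\<close>

lemma alternating_power_sum_poly:
  "\<exists>p :: rat poly. degree p \<le> max i j \<and>
     (\<forall>n. (\<Sum>k\<le>2*n. (-1) ^ k * (of_nat k ^ i * of_nat (2*n-k) ^ j)) = poly p (of_nat n))"
proof (induction "i + j" arbitrary: i j rule: less_induct)
  case less
  define S :: "nat \<Rightarrow> nat \<Rightarrow> nat \<Rightarrow> rat" where
    "S = (\<lambda>i j n. \<Sum>k\<le>2*n. (-1) ^ k * (of_nat k ^ i * of_nat (2*n-k) ^ j))"
  have "\<exists>p. degree p \<le> max i' j \<and> (\<forall>n. S i' j n = poly p (of_nat n))" if "i' < i" for i'
    unfolding S_def using less that by simp
  then obtain p where p: "\<And>i'. i' < i \<Longrightarrow> degree (p i') \<le> max i' j"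
     "\<And>i' n. i' < i \<Longrightarrow> S i' j n = poly (p i') (of_nat n)"
    by metis
  have "\<exists>p. degree p \<le> max i j' \<and> (\<forall>n. S i j' n = poly p (of_nat n))" if "j' < j" for j'
    unfolding S_def using less that by simp
  then obtain q where q: "\<And>j'. j' < j \<Longrightarrow> degree (q j') \<le> max i j'"
     "\<And>j' n. j' < j \<Longrightarrow> S i j' n = poly (q j') (of_nat n)"
    by metis
  define P :: "rat poly" where "P = smult (1/2) (smult (0 ^ j) ([:1, 2:] ^ i) + smult (0 ^ i) ([:1, 2:] ^ j)
     - (\<Sum>i'<i. smult (of_nat (i choose i')) (p i')) - (\<Sum>j'<j. smult (of_nat (j choose j')) (q j')))"
  have deg_lin: "degree ([:1, 2:] ^ m :: rat poly) \<le> m" for m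
    using degree_power_le [of "[:1, 2:] :: rat poly" m] by simp
  have "degree (p i') \<le> max i j" if "i' < i" for i'
    using p(1) [OF that] that by linarith
  moreover have "degree (q j') \<le> max i j" if "j' < j" for j'
    using q(1) [OF that] that by linarith
  ultimately have "degree P \<le> max i j"
    unfolding P_def
    by (intro order.trans [OF degree_smult_le] degree_diff_le degree_add_le degree_sum_le)
       (auto intro: order.trans [OF degree_smult_le] order.trans [OF deg_lin])
  moreover have "S i j n = poly P (of_nat n)" for n
    using alternating_power_sum_recurrence [where i = i and j = j and n = n,
        folded fun_cong [OF fun_cong [OF fun_cong [OF S_def]]]]
    by (simp add: P_def poly_sum p(2) q(2) algebra_simps)
  ultimately show ?case unfolding S_def by blast
qed

section \<open>Finite differences and the moment polynomials\<close>

text \<open>Up to sign this is the M-th finite difference of p at 0, and a single difference lowers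
  the degree or kills a constant. The disjunct \<open>p = 0\<close> lets the induction start at M =
  0, where no polynomial has degree below M.\<close>

lemma alternating_binomial_sum_eq_0:
  fixes p :: "'a :: idom poly"
  assumes "p = 0 \<or> degree p < M"
  shows "(\<Sum>s\<le>M. (-1) ^ s * of_nat (M choose s) * poly p (of_nat s)) = 0"
  using assms
proof (induction M arbitrary: p)
  case (Suc M)
  define q where "q = p - pcompose p [:1, 1:]"
  have q: "poly q (of_nat s) = poly p (of_nat s) - poly p (of_nat (Suc s))" for s
    by (simp add: q_def poly_pcompose)
  have "q = 0 \<or> degree q < M"
  proof (cases "degree p = 0")
    case True
    then show ?thesis by (auto simp: q_def elim: degree_eq_zeroE)
  next
    case False
    have "degree q \<le> degree p"
      unfolding q_def by (intro degree_diff_le order.trans [OF degree_pcompose_le]) auto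
    moreover have "coeff q (degree p) = 0"
      using lead_coeff_comp [of "[:1, 1:]" p] by (simp add: q_def degree_pcompose)
    ultimately have "q = 0 \<or> degree q < degree p"
      using eq_zero_or_degree_less by blast
    with Suc.prems False show ?thesis by auto
  qed
  hence "0 = (\<Sum>s\<le>M. (-1) ^ s * of_nat (M choose s) * poly q (of_nat s))"
    by (simp add: Suc.IH)
  also have "\<dots> = (\<Sum>s\<le>M. (-1) ^ s * of_nat (M choose s) * poly p (of_nat s))
      + (\<Sum>s\<le>M. (-1) ^ Suc s * of_nat (M choose s) * poly p (of_nat (Suc s)))"
    by (simp add: q algebra_simps sum_subtractf sum_negf)
  also have "(\<Sum>s\<le>M. (-1) ^ s * of_nat (M choose s) * poly p (of_nat s)) =
     (\<Sum>s\<le>Suc M. (-1) ^ s * of_nat (M choose s) * poly p (of_nat s))"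
    by (simp add: binomial_eq_0)
  also have "\<dots> = poly p 0 + (\<Sum>s\<le>M. (-1) ^ Suc s * of_nat (M choose Suc s) * poly p (of_nat (Suc s)))"
    by (subst sum.atMost_Suc_shift) simp
  \<comment> \<open>Pascal's rule merges the two sums.\<close>
  also have "\<dots> + (\<Sum>s\<le>M. (-1) ^ Suc s * of_nat (M choose s) * poly p (of_nat (Suc s))) =
    poly p 0 + (\<Sum>s\<le>M. (-1) ^ Suc s * of_nat (Suc M choose Suc s) * poly p (of_nat (Suc s)))"
    unfolding add.assoc sum.distrib [symmetric] by (simp add: algebra_simps)
  also have "\<dots> = (\<Sum>s\<le>Suc M. (-1) ^ s * of_nat (Suc M choose s) * poly p (of_nat s))"
    unfolding sum.atMost_Suc_shift [of _ M] by simp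
  finally show ?case by simp
qed auto

text \<open>
  The image of \<open>(1 - a)\<^sup>2\<^sup>l\<^sup>-\<^sup>1 (a\<^sup>2\<^sup>n\<^sup>-\<^sup>2\<^sup>l - a)\<close> under the linear functional
  \<open>a\<^sup>p \<mapsto> (p/2)\<^sup>i ((2n-p)/2)\<^sup>j\<close>, as a polynomial in \<open>n\<close>.
\<close>

definition moment_poly :: "nat \<Rightarrow> nat \<Rightarrow> nat \<Rightarrow> rat poly" where
  "moment_poly i j l = smult (1 / 2 ^ (i + j)) (\<Sum>s\<le>2*l-1. smult ((-1) ^ s * of_nat ((2*l-1) choose s))
     (smult ((2 * of_nat l - of_nat s) ^ j) ([:of_nat s - 2 * of_nat l, 2:] ^ i)
      - smult ((of_nat s + 1) ^ i) ([:- of_nat s - 1, 2:] ^ j)))"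

text \<open>For the exponents p = s + 2n - 2l and p = s + 1 that occur, one of p and 2n - p is free
  of n, so only one of the two powers contributes to the degree.\<close>

lemma degree_moment_poly: "degree (moment_poly i j l) \<le> max i j"
proof -
  have deg_lin: "degree ([:c, 2:] ^ m :: rat poly) \<le> m" for m c
    using degree_power_le [of "[:c, 2:] :: rat poly" m] by simp
  show ?thesis
    unfolding moment_poly_def
    by (intro order.trans [OF degree_smult_le] degree_sum_le degree_diff_le)
       (auto intro!: order.trans [OF degree_smult_le] order.trans [OF deg_lin])
qed

lemma poly_moment_poly:
  "poly (moment_poly i j l) x = (\<Sum>s\<le>2*l-1. (-1) ^ s * of_nat ((2*l-1) choose s) *
     (((of_nat s + 2 * x - 2 * of_nat l) / 2) ^ i * ((2 * of_nat l - of_nat s) / 2) ^ j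
      - ((of_nat s + 1) / 2) ^ i * ((2 * x - of_nat s - 1) / 2) ^ j))"
proof -
  have scale: "1 / 2 ^ (i + j) * (c * (B ^ j * A ^ i - D ^ i * E ^ j)) =
      c * ((A / 2) ^ i * (B / 2) ^ j - (D / 2) ^ i * (E / 2) ^ j)" for A B c D E :: rat
    by (simp add: power_divide power_add right_diff_distrib diff_divide_distrib mult_ac)
  show ?thesis
    unfolding moment_poly_def poly_smult poly_sum sum_distrib_left poly_diff poly_power scale
    by (intro sum.cong refl) (simp add: algebra_simps)
qed

text \<open>As polynomials in s, the two products have degree i + j and the same leading coefficient
  (-1)^j, so their difference has degree below i + j \<le> 2l - 1 or is zero, and the difference of
  order 2l - 1 kills it. The cancellation of the leading terms reflects the zero of a^(2n-2l) - a at
  a = 1.\<close>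

lemma moment_poly_vanishes:
  assumes "2 * l > i + j"
  shows "poly (moment_poly i j l) x = 0"
proof -
  define A B :: "rat poly" where "A = [:2*x - 2 * of_nat l, 1:] ^ i * [:2 * of_nat l, -1:] ^ j"
    and "B = [:1, 1:] ^ i * [:2*x - 1, -1:] ^ j"
  have lead: "degree ([:c, 1:] ^ i * [:e, -1:] ^ j :: rat poly) = i + j"
    "coeff ([:c, 1:] ^ i * [:e, -1:] ^ j :: rat poly) (i + j) = (-1) ^ j" for c e
  proof -
    show *: "degree ([:c, 1:] ^ i * [:e, -1:] ^ j :: rat poly) = i + j"
      by (subst degree_mult_eq) (auto simp: degree_power_eq)
    show "coeff ([:c, 1:] ^ i * [:e, -1:] ^ j :: rat poly) (i + j) = (-1) ^ j"
      using lead_coeff_mult [of "[:c, 1:] ^ i" "[:e, -1:] ^ j"] by (simp add: * lead_coeff_power)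
  qed
  have "degree (A - B) \<le> i + j" "coeff (A - B) (i + j) = 0"
    unfolding A_def B_def by (intro degree_diff_le) (simp_all add: lead)
  hence "A - B = 0 \<or> degree (A - B) < i + j"
    using eq_zero_or_degree_less by blast
  hence "A - B = 0 \<or> degree (A - B) < 2*l-1" using assms by auto
  hence "(\<Sum>s\<le>2*l-1. (-1) ^ s * of_nat ((2*l-1) choose s) * poly (A - B) (of_nat s)) = 0"
    by (rule alternating_binomial_sum_eq_0)
  also have "(\<Sum>s\<le>2*l-1. (-1) ^ s * of_nat ((2*l-1) choose s) * poly (A - B) (of_nat s)) = 
     2 ^ (i + j) * poly (moment_poly i j l) x"
  proof -
    have scale: "c * (A' ^ i * B' ^ j - D ^ i * E ^ j) =
        2 ^ (i + j) * (c * ((A' / 2) ^ i * (B' / 2) ^ j - (D / 2) ^ i * (E / 2) ^ j))" for A' B' c D E :: rat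
      by (simp add: power_divide power_add right_diff_distrib mult_ac)
    show ?thesis
      unfolding poly_moment_poly sum_distrib_left A_def B_def poly_diff poly_power poly_mult
      by (intro sum.cong refl, subst scale) (simp add: algebra_simps)
  qed
  finally show ?thesis by simp
qed

section \<open>The generating function of the even zeta values\<close>

text \<open>Fubini for series: the product majorant makes the double family absolutely summable, so
  both iterated sums give its total. It serves both the cotangent expansion and the recurrence for
  the zeta series.\<close>

lemma sums_swap_dominated:
  fixes f :: "nat \<Rightarrow> nat \<Rightarrow> 'a :: banach" and a b :: "nat \<Rightarrow> real"
  assumes bound: "\<And>m k. norm (f m k) \<le> a m * b k"
    and "summable a" "summable b" "\<And>m. a m \<ge> 0" "\<And>k. b k \<ge> 0"
    and row: "\<And>m. f m sums r m" and total: "r sums S" and col: "\<And>k. (\<lambda>m. f m k) sums c k"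
  shows "c sums S"
proof -
  have "(\<lambda>(m, k). a m * b k) summable_on UNIV \<times> UNIV"
  proof (rule summable_on_SigmaI)
    fix m
    have "(b has_sum suminf b) UNIV"
      using assms by (intro sums_nonneg_imp_has_sum summable_sums)
    thus "((\<lambda>k. case (m, k) of (m, k) \<Rightarrow> a m * b k) has_sum a m * suminf b) UNIV"
      by (auto intro: has_sum_cmult_right)
  next
    show "(\<lambda>m. a m * suminf b) summable_on UNIV"
      using assms by (intro summable_on_cmult_left) (simp add: summable_on_UNIV_nonneg_real_iff)
  qed (use assms in auto)
  hence "(\<lambda>p. norm (f (fst p) (snd p))) summable_on UNIV \<times> UNIV"
    by (rule Infinite_Sum.abs_summable_on_comparison_test') (auto simp: bound)
  hence "(\<lambda>p. f (fst p) (snd p)) summable_on UNIV \<times> UNIV"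
    by (rule abs_summable_summable)
  then obtain S' where S': "((\<lambda>p. f (fst p) (snd p)) has_sum S') (UNIV \<times> UNIV)"
    by (auto simp: summable_on_def)
  have "summable (\<lambda>k. norm (f m k))" for m
    by (rule summable_comparison_test' [OF summable_mult [OF \<open>summable b\<close>, of "a m"]])
       (use bound in auto)
  hence row': "(f m has_sum r m) UNIV" for m
    using row by (intro norm_summable_imp_has_sum)
  have "summable (\<lambda>m. norm (f m k))" for k
    by (rule summable_comparison_test' [OF summable_mult2 [OF \<open>summable a\<close>, of "b k"]])
       (use bound in auto)
  hence col': "((\<lambda>m. f m k) has_sum c k) UNIV" for k
    using col by (intro norm_summable_imp_has_sum)
  have "(r has_sum S') UNIV"
    using has_sum_SigmaD [OF S', of r] row' by simp
  hence "S' = S"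
    using has_sum_imp_sums sums_unique2 total by blast
  moreover have "(c has_sum S') UNIV"
    using has_sum_SigmaD [OF S' [unfolded has_sum_swap [of "\<lambda>p. f (fst p) (snd p)"]], of c] col' by simp
  ultimately show ?thesis
    using has_sum_imp_sums by blast
qed

text \<open>The value -1/2 at 0 is the constant term of -(pi x/2) cot(pi x). That it also equals
  zeta(0) is only proved with \<open>riemann_zeta_even\<close>.\<close>

definition even_zeta :: "nat \<Rightarrow> complex" where
  "even_zeta k = (if k = 0 then -1/2 else (\<Sum>m. 1 / of_nat (Suc m) ^ (2 * k)))"

lemma even_zeta_0 [simp]: "even_zeta 0 = -1/2"
  by (simp add: even_zeta_def)

lemma summable_norm_inverse_power:
  assumes "k \<ge> 2"
  shows "summable (\<lambda>m. norm (1 / of_nat (Suc m) ^ k :: complex))"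
proof -
  have "summable (\<lambda>m. inverse (real (Suc m) ^ k))"
    by (subst summable_Suc_iff) (rule inverse_power_summable [OF assms])
  thus ?thesis
    by (simp add: norm_divide norm_power inverse_eq_divide del: of_nat_Suc)
qed

lemma even_zeta_sums:
  assumes "k > 0"
  shows "(\<lambda>m. 1 / of_nat (Suc m) ^ (2 * k)) sums even_zeta k"
  unfolding even_zeta_def using assms
  by (auto intro!: summable_sums summable_norm_cancel [OF summable_norm_inverse_power] simp del: of_nat_Suc)

text \<open>Differentiate the reflection formula 1/(Gamma(z) Gamma(1-z)) = sin(pi z)/pi on both
  sides and divide by it.\<close>

lemma pi_cot_conv_Digamma:
  assumes "z \<notin> \<int>"
  shows "of_real pi * cot (of_real pi * z) = Digamma (1 - z) - Digamma (z :: complex)"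
proof -
  have nz: "z \<notin> \<int>\<^sub>\<le>\<^sub>0" "1 - z \<notin> \<int>\<^sub>\<le>\<^sub>0"
    using assms Ints_diff [of 1 "1 - z"] by (auto dest: nonpos_Ints_Int)
  have "((\<lambda>z. rGamma z * rGamma (1 - z)) has_field_derivative
          rGamma z * rGamma (1 - z) * (Digamma (1 - z) - Digamma z)) (at z)"
    using nz by (auto intro!: derivative_eq_intros simp: algebra_simps)
  moreover have "((\<lambda>z. sin (of_real pi * z) / of_real pi) has_field_derivative cos (of_real pi * z)) (at z)"
    by (auto intro!: derivative_eq_intros)
  ultimately have "rGamma z * rGamma (1 - z) * (Digamma (1 - z) - Digamma z) = cos (of_real pi * z)"
    unfolding rGamma_reflection_complex by (rule DERIV_unique)
  moreover have "sin (of_real pi * z) \<noteq> 0"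
    using assms by (auto simp: sin_eq_0)
  ultimately show ?thesis
    unfolding rGamma_reflection_complex by (simp add: cot_def field_simps)
qed

text \<open>With M = m + 1, the Digamma series at 1 + x and 1 - x differ termwise by 1/(M-x) -
  1/(M+x), which times x/2 is x^2/(M^2-x^2). The value comes from the reflection formula; the 1/2
  comes from Digamma(1+x) = Digamma(x) + 1/x.\<close>

lemma cot_partial_fractions:
  fixes x :: complex
  assumes "norm x < 1" "x \<noteq> 0"
  shows "(\<lambda>m. x\<^sup>2 / (of_nat (Suc m) ^ 2 - x\<^sup>2)) sums (1/2 - of_real pi * x / 2 * cot (of_real pi * x))"
proof -
  have "x \<notin> \<int>"
    using assms by (auto elim!: Ints_cases)
  have x1: "1 + x \<noteq> 0" "1 - x \<noteq> 0"
    using assms by (auto simp: add_eq_0_iff)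
  have nz: "of_nat (Suc m) - x \<noteq> 0" "of_nat (Suc m) + x \<noteq> 0" for m
  proof -
    have "norm x < of_nat (Suc m)" using assms by simp
    hence "x \<noteq> of_nat (Suc m)" "- x \<noteq> of_nat (Suc m)"
      by (metis norm_of_nat order_less_irrefl, metis norm_minus_cancel norm_of_nat order_less_irrefl)
    thus "of_nat (Suc m) - x \<noteq> 0" "of_nat (Suc m) + x \<noteq> 0"
      by (auto simp: eq_neg_iff_add_eq_0 [symmetric] simp del: of_nat_Suc)
  qed
  have D: "(\<lambda>m. inverse (of_nat (Suc m)) - inverse (w + of_nat m)) sums (Digamma w + euler_mascheroni)"
    if "w \<noteq> 0" for w :: complex
    using summable_sums [OF summable_Digamma [OF that]] by (simp add: Digamma_def)
  have "(\<lambda>m. (x / 2) * ((inverse (of_nat (Suc m)) - inverse (1 + x + of_nat m)) -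
          (inverse (of_nat (Suc m)) - inverse (1 - x + of_nat m)))) sums
        ((x / 2) * ((Digamma (1 + x) + euler_mascheroni) - (Digamma (1 - x) + euler_mascheroni)))"
    using x1 by (intro sums_mult sums_diff D)
  also have "(\<lambda>m. (x / 2) * ((inverse (of_nat (Suc m)) - inverse (1 + x + of_nat m)) -
          (inverse (of_nat (Suc m)) - inverse (1 - x + of_nat m)))) =
        (\<lambda>m. x\<^sup>2 / (of_nat (Suc m) ^ 2 - x\<^sup>2))"
  proof
    fix m
    define M :: complex where "M = of_nat (Suc m)"
    have M: "1 + x + of_nat m = M + x" "1 - x + of_nat m = M - x"
      by (simp_all add: M_def)
    have "M + x \<noteq> 0" "M - x \<noteq> 0"
      using nz [of m] by (simp_all add: M_def)
    hence "x / 2 * (inverse (M - x) - inverse (M + x)) = x\<^sup>2 / ((M + x) * (M - x))"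
      by (simp add: divide_simps) (simp add: power2_eq_square algebra_simps)
    thus "(x / 2) * ((inverse (of_nat (Suc m)) - inverse (1 + x + of_nat m)) -
          (inverse (of_nat (Suc m)) - inverse (1 - x + of_nat m))) = x\<^sup>2 / (of_nat (Suc m) ^ 2 - x\<^sup>2)"
      unfolding M M_def [symmetric] by (simp add: power2_eq_square algebra_simps)
  qed
  also have "(x / 2) * ((Digamma (1 + x) + euler_mascheroni) - (Digamma (1 - x) + euler_mascheroni)) =
     1/2 - of_real pi * x / 2 * cot (of_real pi * x)"
  proof -
    have "x / 2 * (of_real pi * cot (of_real pi * x)) = x / 2 * (Digamma (1 - x) - Digamma x)"
      using pi_cot_conv_Digamma [OF \<open>x \<notin> \<int>\<close>] by simp
    moreover have "Digamma (1 + x) = Digamma x + 1 / x"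
      using Digamma_plus1 [of x] assms(2) by (simp add: add.commute)
    ultimately show ?thesis
      using assms(2) by (simp add: algebra_simps add_divide_distrib)
  qed
  finally show ?thesis .
qed

text \<open>Expand each partial fraction of the cotangent as a geometric series in x^2/M^2 and sum
  over M first.\<close>

lemma even_zeta_generating_function:
  assumes "norm x < 1" "x \<noteq> 0"
  shows "(\<lambda>k. even_zeta k * (x\<^sup>2) ^ k) sums (- (of_real pi * x / 2) * cot (of_real pi * x))"
proof -
  define q where "q = norm x ^ 2"
  have q: "0 \<le> q" "q < 1" using assms by (auto simp: q_def power_less_one_iff)
  have "(\<lambda>k. even_zeta (Suc k) * (x\<^sup>2) ^ Suc k) sums (1/2 - of_real pi * x / 2 * cot (of_real pi * x))"
  proof (rule sums_swap_dominated)
    \<comment> \<open>Since 1/M^2 \<le> 1, its higher powers are bounded by 1/M^2 itself, which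
      leaves a product of a convergent series in m and a geometric one in k.\<close>
    show "norm ((x\<^sup>2 / of_nat (Suc m) ^ 2) ^ Suc k) \<le> norm (1 / of_nat (Suc m) ^ 2 :: complex) * q ^ Suc k" for m k
    proof -
      have "norm ((x\<^sup>2 / of_nat (Suc m) ^ 2) ^ Suc k) = (1 / real (Suc m) ^ 2) ^ Suc k * q ^ Suc k"
        by (simp add: norm_power norm_divide q_def power_divide del: of_nat_Suc power_Suc)
      also have "(1 / real (Suc m) ^ 2) ^ Suc k \<le> 1 / real (Suc m) ^ 2"
        by (rule power_Suc_le_self) (auto simp: divide_simps simp del: of_nat_Suc)
      finally show ?thesis using q
        by (simp add: norm_power norm_divide mult_right_mono del: of_nat_Suc power_Suc)
    qed
    show "summable (\<lambda>m. norm (1 / of_nat (Suc m) ^ 2 :: complex))"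
      by (rule summable_norm_inverse_power) simp
    show "summable (\<lambda>k. q ^ Suc k)"
      using q by (subst summable_Suc_iff) (simp add: summable_geometric)
    show "(\<lambda>k. (x\<^sup>2 / of_nat (Suc m) ^ 2) ^ Suc k) sums (x\<^sup>2 / (of_nat (Suc m) ^ 2 - x\<^sup>2))" for m
    proof -
      define t where "t = x\<^sup>2 / of_nat (Suc m) ^ 2"
      have "norm t \<le> q / 1"
        unfolding t_def norm_divide norm_power q_def
        by (intro divide_left_mono) (auto simp del: of_nat_Suc)
      hence t: "norm t < 1" using q by simp
      hence "t \<noteq> 1" by auto
      have "(\<lambda>k. t * t ^ k) sums (t * (1 / (1 - t)))"
        by (intro sums_mult geometric_sums t)
      also have "t * (1 / (1 - t)) = x\<^sup>2 / (of_nat (Suc m) ^ 2 - x\<^sup>2)"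
        using \<open>t \<noteq> 1\<close> by (simp add: t_def divide_simps del: of_nat_Suc)
      finally show ?thesis unfolding t_def power_Suc .
    qed
    show "(\<lambda>m. x\<^sup>2 / (of_nat (Suc m) ^ 2 - x\<^sup>2)) sums (1/2 - of_real pi * x / 2 * cot (of_real pi * x))"
      by (rule cot_partial_fractions) fact+
    show "(\<lambda>m. (x\<^sup>2 / of_nat (Suc m) ^ 2) ^ Suc k) sums (even_zeta (Suc k) * (x\<^sup>2) ^ Suc k)" for k
      using sums_mult2 [OF even_zeta_sums [of "Suc k"], of "(x\<^sup>2) ^ Suc k"]
      by (simp add: power_divide power_mult del: of_nat_Suc power_Suc mult_Suc_right)
  qed (use q in auto)
  \<comment> \<open>The term of index 0 is -1/2 and cancels the 1/2.\<close>
  hence "(\<lambda>k. even_zeta k * (x\<^sup>2) ^ k) sums (1/2 - of_real pi * x / 2 * cot (of_real pi * x) + even_zeta 0 * (x\<^sup>2) ^ 0)"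
    by (subst (asm) sums_Suc_iff) simp
  thus ?thesis by simp
qed

text \<open>The addition theorem for (1-a)x = x - ax, with denominators cleared. Being quadratic in
  cotangents, it turns into a relation between convolutions of even zeta values.\<close>

lemma cot_product_identity:
  fixes x :: complex
  assumes "sin (a * x) \<noteq> 0" "sin x \<noteq> 0" "sin ((1 - a) * x) \<noteq> 0"
  shows "cot (a * x) * cot x = cot ((1 - a) * x) * (cot (a * x) - cot x) - 1"
proof -
  have s: "sin ((1 - a) * x) = sin x * cos (a * x) - cos x * sin (a * x)"
    using sin_diff [of x "a * x"] by (simp add: algebra_simps)
  have c: "cos ((1 - a) * x) = cos x * cos (a * x) + sin x * sin (a * x)"
    using cos_diff [of x "a * x"] by (simp add: algebra_simps)
  have "cot (a * x) - cot x = sin ((1 - a) * x) / (sin (a * x) * sin x)"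
    using assms(1,2) unfolding s by (simp add: cot_def field_simps)
  hence "cot ((1 - a) * x) * (cot (a * x) - cot x) = cos ((1 - a) * x) / (sin (a * x) * sin x)"
    using assms(3) by (simp add: cot_def)
  thus ?thesis
    using assms(1,2) unfolding c by (simp add: cot_def field_simps)
qed

lemma sin_pi_times_neq_0:
  assumes "norm x < 1" "x \<noteq> (0 :: complex)"
  shows "sin (of_real pi * x) \<noteq> 0"
proof
  assume "sin (of_real pi * x) = 0"
  then obtain n where "of_real pi * x = of_real (of_int n * pi)"
    by (auto simp: sin_eq_0)
  hence "x = of_int n" by simp
  with assms show False by simp
qed

text \<open>Multiply the cotangent identity at y = pi x by (1-a) a y^2/4 and compare coefficients of
  x^(2n). The constant -1 of that identity becomes a multiple of x^2, so it affects n = 1 only. The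
  norm conditions keep ax and (1-a)x in the unit disc.\<close>

lemma even_zeta_convolution:
  fixes a :: complex and n :: nat
  assumes a: "norm a \<le> 1" "norm (1 - a) \<le> 1" "a \<noteq> 0" "a \<noteq> 1" and n: "n \<noteq> 1"
  shows "(1 - a) * (\<Sum>k\<le>n. a ^ (2*k) * even_zeta k * even_zeta (n - k)) =
         (\<Sum>l\<le>n. (1 - a) ^ (2*l) * even_zeta l * ((a ^ (2*(n-l)) - a) * even_zeta (n - l)))"
proof -
  \<comment> \<open>\<open>H c\<close> is the power series of -(pi c x/2) cot(pi c x) in the
    variable t = x^2.\<close>
  define H where "H = (\<lambda>c. Abs_fps (\<lambda>k. c ^ (2*k) * even_zeta k))"
  have less: "norm (c * x) < 1" if "norm c \<le> 1" "norm x < 1" for c x :: complex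
    using that mult_left_le_one_le [of "norm x" "norm c"] by (simp add: norm_mult)
  have sums: "(\<lambda>k. even_zeta k * ((c * x)\<^sup>2) ^ k) sums (- (of_real pi * (c * x) / 2) * cot (of_real pi * (c * x)))"
    if "norm c \<le> 1" "c \<noteq> 0" "norm x < 1" "x \<noteq> 0" for c x
    using that less by (intro even_zeta_generating_function) auto
  have H_sums: "(\<lambda>k. fps_nth (H c) k * (x\<^sup>2) ^ k) sums (- (of_real pi * (c * x) / 2) * cot (of_real pi * (c * x)))"
    if "norm c \<le> 1" "c \<noteq> 0" "norm x < 1" "x \<noteq> 0" for c x
    using sums [OF that] by (simp add: H_def power_mult_distrib power_even_eq mult_ac flip: power_mult)
  have H_eval: "eval_fps (H c) (x\<^sup>2) = - (of_real pi * (c * x) / 2) * cot (of_real pi * (c * x))"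
    if "norm c \<le> 1" "c \<noteq> 0" "norm x < 1" "x \<noteq> 0" for c x
    using H_sums [OF that] by (simp add: eval_fps_def sums_iff)
  have H_eval0: "eval_fps (H c) 0 = - 1/2" for c
    by (simp add: eval_fps_at_0 H_def)
  have rad: "fps_conv_radius (H c) > 0" if "norm c \<le> 1" "c \<noteq> 0" for c
  proof -
    \<comment> \<open>Convergence at the single point x = 1/2 already gives a positive
      radius.\<close>
    have "fps_conv_radius (H c) \<ge> norm ((1/2 :: complex)\<^sup>2)"
      unfolding fps_conv_radius_def
      using H_sums [OF that, of "1/2"] by (intro conv_radius_geI) (auto simp: sums_iff)
    thus ?thesis by (rule less_le_trans [rotated]) (simp add: norm_power zero_ereal_def)
  qed
  have exp: "eval_fps (H c) has_fps_expansion H c" if "norm c \<le> 1" "c \<noteq> 0" for c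
    by (intro eval_fps_has_fps_expansion rad that)
  have 1: "(\<lambda>t. (1 - a) * (eval_fps (H a) t * eval_fps (H 1) t) + (1 - a) * a * of_real pi ^ 2 / 4 * t) has_fps_expansion
        fps_const (1 - a) * (H a * H 1) + fps_const ((1 - a) * a * of_real pi ^ 2 / 4) * fps_X"
    using a by (intro fps_expansion_intros exp) auto
  have 2: "(\<lambda>t. eval_fps (H (1 - a)) t * (eval_fps (H a) t - a * eval_fps (H 1) t)) has_fps_expansion
        H (1 - a) * (H a - fps_const a * H 1)"
    using a by (intro fps_expansion_intros exp) auto
  have "(1 - a) * (eval_fps (H a) t * eval_fps (H 1) t) + (1 - a) * a * of_real pi ^ 2 / 4 * t =
        eval_fps (H (1 - a)) t * (eval_fps (H a) t - a * eval_fps (H 1) t)" if t: "norm t < 1" for t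
  proof (cases "t = 0")
    case False
    define x where "x = csqrt t"
    have tx: "t = x\<^sup>2" by (simp add: x_def)
    have x: "x \<noteq> 0" "norm x < 1"
      using False t by (auto simp: tx norm_power power_less_one_iff)
    define y where "y = of_real pi * x"
    have yc: "of_real pi * (c * x) = c * y" for c by (simp add: y_def)
    define A B C where "A = cot (a * y)" and "B = cot y" and "C = cot ((1 - a) * y)"
    have AB: "A * B = C * (A - B) - 1"
      unfolding A_def B_def C_def
    proof (rule cot_product_identity)
      show "sin (a * y) \<noteq> 0" "sin y \<noteq> 0" "sin ((1 - a) * y) \<noteq> 0"
        using sin_pi_times_neq_0 [of "a * x"] sin_pi_times_neq_0 [of x] sin_pi_times_neq_0 [of "(1 - a) * x"]
          a x less [of a x] less [of "1 - a" x] by (auto simp: y_def mult_ac)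
    qed
    have E: "eval_fps (H a) t = - (a * y / 2) * A" "eval_fps (H 1) t = - (y / 2) * B"
       "eval_fps (H (1 - a)) t = - ((1 - a) * y / 2) * C"
      using H_eval [of a x] H_eval [of 1 x] H_eval [of "1 - a" x] a x
      unfolding tx A_def B_def C_def yc by (simp_all add: y_def)
    have "of_real pi ^ 2 * t = y\<^sup>2" by (simp add: y_def tx power_mult_distrib)
    hence pit: "(1 - a) * a * of_real pi ^ 2 / 4 * t = (1 - a) * a * y\<^sup>2 / 4"
      by (metis (no_types) mult.assoc times_divide_eq_left)
    have "(1 - a) * (eval_fps (H a) t * eval_fps (H 1) t) + (1 - a) * a * of_real pi ^ 2 / 4 * t =
         (1 - a) * a * y\<^sup>2 / 4 * (A * B + 1)"
      unfolding pit E by (simp add: power2_eq_square field_simps)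
    also have "\<dots> = eval_fps (H (1 - a)) t * (eval_fps (H a) t - a * eval_fps (H 1) t)"
      unfolding AB E by (simp add: power2_eq_square field_simps)
    finally show ?thesis .
  qed (simp add: H_eval0 field_simps)
  hence "eventually (\<lambda>t. (1 - a) * (eval_fps (H a) t * eval_fps (H 1) t) + (1 - a) * a * of_real pi ^ 2 / 4 * t =
        eval_fps (H (1 - a)) t * (eval_fps (H a) t - a * eval_fps (H 1) t)) (nhds 0)"
    unfolding eventually_nhds_metric by (intro exI [of _ 1]) auto
  with 1 have "(\<lambda>t. eval_fps (H (1 - a)) t * (eval_fps (H a) t - a * eval_fps (H 1) t)) has_fps_expansion
        fps_const (1 - a) * (H a * H 1) + fps_const ((1 - a) * a * of_real pi ^ 2 / 4) * fps_X"
    by (simp add: has_fps_expansion_cong)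
  hence "fps_const (1 - a) * (H a * H 1) + fps_const ((1 - a) * a * of_real pi ^ 2 / 4) * fps_X =
      H (1 - a) * (H a - fps_const a * H 1)"
    using 2 by (rule fps_expansion_unique_complex)
  hence "fps_nth (fps_const (1 - a) * (H a * H 1) + fps_const ((1 - a) * a * of_real pi ^ 2 / 4) * fps_X) n =
      fps_nth (H (1 - a) * (H a - fps_const a * H 1)) n"
    by simp
  moreover have "fps_nth (fps_const (1 - a) * (H a * H 1) + fps_const ((1 - a) * a * of_real pi ^ 2 / 4) * fps_X) n =
      (1 - a) * fps_nth (H a * H 1) n"
    using n by simp
  moreover have "fps_nth (H a * H 1) n = (\<Sum>k\<le>n. a ^ (2*k) * even_zeta k * even_zeta (n - k))"
    by (simp add: fps_mult_nth H_def atLeast0AtMost)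
  moreover have "fps_nth (H (1 - a) * (H a - fps_const a * H 1)) n =
      (\<Sum>l\<le>n. fps_nth (H (1 - a)) l * fps_nth (H a - fps_const a * H 1) (n - l))"
    by (simp only: fps_mult_nth atLeast0AtMost)
  ultimately show ?thesis
    by (simp add: H_def left_diff_distrib)
qed

section \<open>Analytic continuation of the zeta function\<close>

text \<open>Factor by factor, |w - i| \<le> R + i = |-R - i|. The bound is uniform on the disc of
  radius R.\<close>

lemma norm_gbinomial_le:
  fixes w :: complex
  assumes "norm w \<le> R"
  shows "norm (w gchoose k) \<le> \<bar>(- R) gchoose k\<bar>"
proof -
  have "(\<Prod>i=0..<k. norm (w - of_nat i)) \<le> (\<Prod>i=0..<k. \<bar>- R - of_nat i\<bar>)"
  proof (rule prod_mono, safe)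
    fix i
    have "norm (w - of_nat i) \<le> norm w + of_nat i"
      using norm_triangle_ineq4 [of w "of_nat i"] by simp
    thus "norm (w - of_nat i) \<le> \<bar>- R - of_nat i\<bar>" using assms by simp
  qed auto
  thus ?thesis
    by (simp add: gbinomial_prod_rev norm_divide prod_norm [symmetric] abs_prod divide_right_mono)
qed

text \<open>These are the absolute values of the even-indexed terms of the binomial series with
  exponent -R at the point 1/2, inside its disc of convergence.\<close>

lemma summable_even_gbinomial: "summable (\<lambda>i. \<bar>(- R :: real) gchoose (2 * i)\<bar> / 4 ^ i)"
proof -
  have "summable (\<lambda>k. norm (((- R) gchoose k) * (1/2) ^ k))"
    by (rule abs_summable_in_conv_radius) (simp add: conv_radius_gchoose one_ereal_def)
  hence "summable ((\<lambda>k. norm (((- R) gchoose k) * (1/2) ^ k)) \<circ> (\<lambda>i. 2 * i))"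
    by (rule summable_reindex) (auto simp: inj_def)
  also have "((\<lambda>k. norm (((- R) gchoose k) * (1/2) ^ k)) \<circ> (\<lambda>i. 2 * i)) =
      (\<lambda>i. \<bar>(- R :: real) gchoose (2 * i)\<bar> / 4 ^ i)"
    by (simp add: fun_eq_iff abs_mult power_mult power_divide)
  finally show ?thesis .
qed

section \<open>The Dirichlet series on its half-plane\<close>

definition zeta_series :: "complex \<Rightarrow> complex" where
  "zeta_series s = (\<Sum>m. of_nat (Suc m) powr (- s))"

lemma norm_nat_powr: "norm (of_nat (Suc m) powr (s :: complex)) = real (Suc m) powr Re s"
  using norm_powr_real_powr [of "of_nat (Suc m)" s] by simp

lemma summable_nat_powr:
  assumes "c > 1"
  shows "summable (\<lambda>m. real (Suc m) powr (- c))"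
proof -
  have "summable (\<lambda>m. real m powr (- c))"
    unfolding summable_real_powr_iff using assms by simp
  thus ?thesis
    by (rule summable_Suc_iff [of "\<lambda>m. real m powr (- c)", THEN iffD2])
qed

lemma zeta_series_sums:
  assumes "Re s > 1"
  shows "(\<lambda>m. of_nat (Suc m) powr (- s)) sums zeta_series s"
proof -
  have "summable (\<lambda>m. norm (of_nat (Suc m) powr (- s)))"
    unfolding norm_nat_powr uminus_complex.sel by (rule summable_nat_powr) fact
  thus ?thesis
    unfolding zeta_series_def by (rule summable_sums [OF summable_norm_cancel])
qed

lemma norm_zeta_series_le:
  assumes "Re s \<ge> 2"
  shows "norm (zeta_series s) \<le> (\<Sum>m. real (Suc m) powr (- 2))"
  unfolding zeta_series_def
proof (rule norm_suminf_le)
  show "summable (\<lambda>m. real (Suc m) powr (- 2))"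
    by (rule summable_nat_powr) simp
  show "norm (of_nat (Suc m) powr (- s)) \<le> real (Suc m) powr (- 2)" for m
    unfolding norm_nat_powr using assms by (intro powr_mono) auto
qed

lemma open_halfplane_cball:
  assumes "Re x > c"
  obtains d where "d > 0" "cball x d \<subseteq> {s. Re s > c}" "\<And>s. s \<in> cball x d \<Longrightarrow> Re s \<ge> c + d"
proof -
  define d where "d = (Re x - c) / 2"
  have *: "Re s \<ge> c + d" if "s \<in> cball x d" for s
  proof -
    have "\<bar>Re (x - s)\<bar> \<le> d"
      using that abs_Re_le_cmod [of "x - s"] by (simp add: dist_norm)
    hence "Re x - Re s \<le> d" by simp
    thus ?thesis by (simp add: d_def field_simps)
  qed
  moreover have "d > 0" using assms by (simp add: d_def)
  ultimately show ?thesis by (intro that [of d]) force+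
qed

lemma zeta_series_holomorphic: "zeta_series holomorphic_on {s. Re s > 1}"
proof (rule holomorphic_uniform_sequence)
  show "open {s. Re s > 1}" by (rule open_halfspace_Re_gt)
  show "(\<lambda>s. \<Sum>m<n. of_nat (Suc m) powr (- s)) holomorphic_on {s. Re s > 1}" for n
    by (intro holomorphic_intros) (auto simp del: of_nat_Suc)
  fix x :: complex assume "x \<in> {s. Re s > 1}"
  then obtain d where d: "d > 0" "cball x d \<subseteq> {s. Re s > 1}" "\<And>s. s \<in> cball x d \<Longrightarrow> Re s \<ge> 1 + d"
    using open_halfplane_cball by blast
  have "uniform_limit (cball x d) (\<lambda>n s. \<Sum>m<n. of_nat (Suc m) powr (- s)) zeta_series sequentially"
    unfolding zeta_series_def
  proof (rule Weierstrass_m_test)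
    show "summable (\<lambda>m. real (Suc m) powr (- (1 + d)))"
      using d by (intro summable_nat_powr) simp
    fix m s assume "s \<in> cball x d"
    thus "norm (of_nat (Suc m) powr (- s)) \<le> real (Suc m) powr (- (1 + d))"
      unfolding norm_nat_powr using d(3) [of s] by (intro powr_mono) auto
  qed
  with d show "\<exists>d>0. cball x d \<subseteq> {s. Re s > 1} \<and>
      uniform_limit (cball x d) (\<lambda>n s. \<Sum>m<n. of_nat (Suc m) powr (- s)) zeta_series sequentially"
    by blast
qed

section \<open>A recurrence in steps of two\<close>

text \<open>Times s + 2i - 1, this is the coefficient of m^(-s-2i) in (m - 1/2)^(1-s) - (m +
  1/2)^(1-s). The factor s + 2i - 1 is kept apart so that the recurrence speaks of (s-1) zeta(s),
  which has no pole.\<close>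

definition zeta_coeff :: "nat \<Rightarrow> complex \<Rightarrow> complex" where
  "zeta_coeff i s = ((1 - s) gchoose (2 * i)) / (4 ^ i * (2 * of_nat i + 1))"

lemma norm_odd: "norm (2 * of_nat i + 1 :: complex) = 2 * real i + 1"
  using norm_of_nat [of "2 * i + 1", where ?'a = complex] by (simp add: add.commute)

text \<open>The denominator 2i + 1 of the coefficient absorbs the linear growth of |s + 2i| + 1
  \<le> (R+1)(2i+1).\<close>

lemma norm_zeta_coeff_le:
  assumes "norm s \<le> R"
  shows "norm (zeta_coeff i s) * (norm (s + 2 * of_nat i) + 1) \<le> (\<bar>(- (1 + R)) gchoose (2 * i)\<bar> / 4 ^ i) * (R + 1)"
proof -
  have "R \<ge> 0" using assms norm_ge_zero order.trans by blast
  have "norm (1 - s) \<le> 1 + R" using assms norm_triangle_ineq4 [of 1 s] by simp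
  hence "norm ((1 - s) gchoose (2 * i)) \<le> \<bar>(- (1 + R)) gchoose (2 * i)\<bar>"
    by (rule norm_gbinomial_le)
  moreover have "norm (s + 2 * of_nat i) + 1 \<le> (R + 1) * (2 * real i + 1)"
  proof -
    have "norm (s + 2 * of_nat i) \<le> norm s + 2 * real i"
      using norm_triangle_ineq [of s "2 * of_nat i"] by (simp add: norm_mult)
    moreover have "0 \<le> R * (2 * real i)" using \<open>R \<ge> 0\<close> by simp
    ultimately show ?thesis using assms by (simp add: algebra_simps)
  qed
  ultimately have "norm ((1 - s) gchoose (2 * i)) * (norm (s + 2 * of_nat i) + 1) \<le>
      \<bar>(- (1 + R)) gchoose (2 * i)\<bar> * ((R + 1) * (2 * real i + 1))"
    by (intro mult_mono) auto
  hence "norm ((1 - s) gchoose (2 * i)) * (norm (s + 2 * of_nat i) + 1) / (4 ^ i * (2 * real i + 1)) \<le>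
      \<bar>(- (1 + R)) gchoose (2 * i)\<bar> * ((R + 1) * (2 * real i + 1)) / (4 ^ i * (2 * real i + 1))"
    by (rule divide_right_mono) simp
  also have "\<dots> = (\<bar>(- (1 + R)) gchoose (2 * i)\<bar> / 4 ^ i) * (R + 1)"
  proof -
    have "2 * real i + 1 \<noteq> 0" by linarith
    thus ?thesis by simp
  qed
  finally show ?thesis
    unfolding zeta_coeff_def norm_divide norm_mult norm_power norm_numeral norm_odd
    by (simp only: times_divide_eq_left)
qed

text \<open>
  The series telescoping \<open>(m - 1/2)\<^sup>1\<^sup>-\<^sup>s - (m + 1/2)\<^sup>1\<^sup>-\<^sup>s\<close>, expanded binomially around \<open>m\<close>.
\<close>

lemma zeta_series_recurrence:
  assumes s: "Re s > 1"
  shows "(\<lambda>i. zeta_coeff i s * ((s + 2 * of_nat i - 1) * zeta_series (s + 2 * of_nat i))) sums (2 powr (s - 1))"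
proof -
  define R where "R = norm s"
  define w where "w = 1 - s"
  show ?thesis
  proof (rule sums_swap_dominated)
    fix m i
    have "real (Suc m) powr (- Re (s + 2 * of_nat i)) \<le> real (Suc m) powr (- Re s)"
      by (intro powr_mono) auto
    moreover have "norm (zeta_coeff i s) * norm (s + 2 * of_nat i - 1) \<le> (\<bar>(- (1 + R)) gchoose (2 * i)\<bar> / 4 ^ i) * (R + 1)"
    proof -
      have "norm (zeta_coeff i s) * norm (s + 2 * of_nat i - 1) \<le> norm (zeta_coeff i s) * (norm (s + 2 * of_nat i) + 1)"
        by (intro mult_left_mono) (use norm_triangle_ineq4 [of "s + 2 * of_nat i" 1] in auto)
      also have "\<dots> \<le> (\<bar>(- (1 + R)) gchoose (2 * i)\<bar> / 4 ^ i) * (R + 1)"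
        by (rule norm_zeta_coeff_le) (simp add: R_def)
      finally show ?thesis .
    qed
    ultimately have "real (Suc m) powr (- Re (s + 2 * of_nat i)) * (norm (zeta_coeff i s) * norm (s + 2 * of_nat i - 1))
        \<le> real (Suc m) powr (- Re s) * ((\<bar>(- (1 + R)) gchoose (2 * i)\<bar> / 4 ^ i) * (R + 1))"
      by (rule mult_mono) auto
    thus "norm (zeta_coeff i s * ((s + 2 * of_nat i - 1) * of_nat (Suc m) powr (- (s + 2 * of_nat i)))) \<le>
        real (Suc m) powr (- Re s) * ((\<bar>(- (1 + R)) gchoose (2 * i)\<bar> / 4 ^ i) * (R + 1))"
      by (simp only: norm_mult norm_nat_powr uminus_complex.sel mult_ac)
  next
    show "summable (\<lambda>m. real (Suc m) powr (- Re s))" by (rule summable_nat_powr) fact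
    show "summable (\<lambda>i. (\<bar>(- (1 + R)) gchoose (2 * i)\<bar> / 4 ^ i) * (R + 1))"
      by (intro summable_mult2 summable_even_gbinomial)
    show "(\<lambda>m. zeta_coeff i s * ((s + 2 * of_nat i - 1) * of_nat (Suc m) powr (- (s + 2 * of_nat i)))) sums
       (zeta_coeff i s * ((s + 2 * of_nat i - 1) * zeta_series (s + 2 * of_nat i)))" for i
      using s by (intro sums_mult zeta_series_sums) simp
  next
    \<comment> \<open>\<open>g m\<close> is (m + 1/2)^(1-s). It tends to 0 as Re s > 1, so the
      telescoping sum is \<open>g 0\<close> = (1/2)^(1-s).\<close>
    define g :: "nat \<Rightarrow> complex" where "g = (\<lambda>m. of_real (1/2 + real m) powr w)"
    have "g \<longlonglongrightarrow> 0"
      unfolding g_def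
    proof (rule tendsto_neg_powr_complex_of_real)
      show "filterlim (\<lambda>m. 1/2 + real m) at_top sequentially"
        by (rule filterlim_tendsto_add_at_top [OF tendsto_const filterlim_real_sequentially])
      show "Re w < 0" using s by (simp add: w_def)
    qed
    hence "(\<lambda>m. g m - g (Suc m)) sums (g 0 - 0)" by (rule telescope_sums')
    also have "g 0 - 0 = 2 powr (s - 1)"
    proof -
      have "g 0 = exp (w * Ln (of_real (1/2)))" by (simp add: g_def powr_def)
      also have "Ln (of_real (1/2)) = - Ln 2"
        by (subst Ln_of_real) (auto simp: ln_div Ln_of_real [of 2, symmetric])
      finally show ?thesis by (simp add: powr_def w_def algebra_simps)
    qed
    finally show "(\<lambda>m. g m - g (Suc m)) sums (2 powr (s - 1))" .
    fix m
    \<comment> \<open>With u = 1/(2M), the numbers M(1-u) and M(1+u) are the bases in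
      \<open>g m\<close> and \<open>g (Suc m)\<close>. In the difference of the two binomial series
      the even powers of u cancel.\<close>
    define M where "M = real (Suc m)"
    define u :: complex where "u = of_real (1 / (2 * M))"
    have M: "M \<ge> 1" by (simp add: M_def)
    have u: "norm u < 1" using M by (simp add: u_def norm_divide)
    have "(\<lambda>k. (w gchoose k) * (- u) ^ k - (w gchoose k) * u ^ k) sums ((1 + - u) powr w - (1 + u) powr w)"
      using u by (intro sums_diff gen_binomial_complex) auto
    hence "(\<lambda>i. (w gchoose (2 * i + 1)) * (- u) ^ (2 * i + 1) - (w gchoose (2 * i + 1)) * u ^ (2 * i + 1)) sums
         ((1 + - u) powr w - (1 + u) powr w)"
    proof (subst sums_mono_reindex [of "\<lambda>i. 2 * i + 1"])
      show "(w gchoose n) * (- u) ^ n - (w gchoose n) * u ^ n = 0" if "n \<notin> range (\<lambda>i. 2 * i + 1)" for n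
      proof -
        have "even n" using that by (metis oddE rangeI)
        thus ?thesis by simp
      qed
    qed (auto simp: strict_mono_def)
    hence "(\<lambda>i. of_real M powr w * ((w gchoose (2 * i + 1)) * (- u) ^ (2 * i + 1) - (w gchoose (2 * i + 1)) * u ^ (2 * i + 1))) sums
         (of_real M powr w * ((1 + - u) powr w - (1 + u) powr w))"
      by (rule sums_mult)
    also have "of_real M powr w * ((1 + - u) powr w - (1 + u) powr w) = g m - g (Suc m)"
    proof -
      have "of_real M powr w * (1 + - u) powr w = (of_real M * (1 + - u)) powr w"
        using M by (subst powr_times_real_left) auto
      also have "of_real M * (1 + - u) = of_real (1/2 + real m)"
      proof -
        have "M * (1 - 1 / (2 * M)) = 1/2 + real m" using M by (simp add: M_def field_simps)
        thus ?thesis unfolding u_def by (metis of_real_1 of_real_diff of_real_mult uminus_add_conv_diff add.commute)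
      qed
      finally have 1: "of_real M powr w * (1 + - u) powr w = g m" by (simp add: g_def)
      have "of_real M powr w * (1 + u) powr w = (of_real M * (1 + u)) powr w"
        using M by (subst powr_times_real_left) auto
      also have "of_real M * (1 + u) = of_real (1/2 + real (Suc m))"
      proof -
        have "M * (1 + 1 / (2 * M)) = 1/2 + real (Suc m)" using M by (simp add: M_def field_simps)
        thus ?thesis unfolding u_def by (metis of_real_1 of_real_add of_real_mult)
      qed
      finally have 2: "of_real M powr w * (1 + u) powr w = g (Suc m)" by (simp add: g_def)
      show ?thesis by (simp only: right_diff_distrib 1 2)
    qed
    also have "(\<lambda>i. of_real M powr w * ((w gchoose (2 * i + 1)) * (- u) ^ (2 * i + 1) - (w gchoose (2 * i + 1)) * u ^ (2 * i + 1))) =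
       (\<lambda>i. zeta_coeff i s * ((s + 2 * of_nat i - 1) * of_nat (Suc m) powr (- (s + 2 * of_nat i))))"
    proof
      fix i
      \<comment> \<open>Passing from the odd to the even binomial coefficient produces the factor s
        + 2i - 1.\<close>
      have ch: "(w gchoose (2 * i + 1)) * (2 * of_nat i + 1) = - (w gchoose (2 * i)) * (s + 2 * of_nat i - 1)"
        using gbinomial_mult_1 [of w "2 * i"] by (simp add: w_def algebra_simps)
      have "of_nat (Suc m) powr (- (s + 2 * of_nat i)) = of_real M powr (w - of_nat (2 * i + 1))"
        by (simp add: M_def w_def algebra_simps)
      also have "\<dots> = of_real M powr w / of_real M ^ (2 * i + 1)"
        using M by (subst powr_diff, subst powr_nat') auto
      finally have pow: "of_nat (Suc m) powr (- (s + 2 * of_nat i)) = of_real M powr w / of_real M ^ (2 * i + 1)" .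
      have up: "u ^ (2 * i + 1) = 1 / (2 * 4 ^ i * of_real M ^ (2 * i + 1))"
        by (simp add: u_def power_divide power_mult_distrib power_mult)
      have nz: "(2 * of_nat i + 1 :: complex) \<noteq> 0"
        using norm_odd [of i] by (auto simp del: norm_eq_zero)
      have "(w gchoose (2 * i + 1)) = - (w gchoose (2 * i)) * (s + 2 * of_nat i - 1) / (2 * of_nat i + 1)"
        by (subst nonzero_eq_divide_eq [OF nz]) (rule ch)
      hence "of_real M powr w * (- 2 * (w gchoose (2 * i + 1)) * u ^ (2 * i + 1)) =
         zeta_coeff i s * ((s + 2 * of_nat i - 1) * of_nat (Suc m) powr (- (s + 2 * of_nat i)))"
        unfolding pow up by (simp add: zeta_coeff_def w_def mult_ac)
      thus "of_real M powr w * ((w gchoose (2 * i + 1)) * (- u) ^ (2 * i + 1) - (w gchoose (2 * i + 1)) * u ^ (2 * i + 1)) =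
        zeta_coeff i s * ((s + 2 * of_nat i - 1) * of_nat (Suc m) powr (- (s + 2 * of_nat i)))"
        by (simp add: algebra_simps)
    qed
    finally show "(\<lambda>i. zeta_coeff i s * ((s + 2 * of_nat i - 1) * of_nat (Suc m) powr (- (s + 2 * of_nat i)))) sums
       (g m - g (Suc m))" .
  qed (auto simp: R_def)
qed

section \<open>Continuation of (s-1) zeta(s) to the plane\<close>

text \<open>The recurrence solved for its term of index 0, whose coefficient is 1. The value at s is
  computed from those at s+2, s+4, and so on, which extends a function two units to the
  left.\<close>

definition zeta_step :: "(complex \<Rightarrow> complex) \<Rightarrow> complex \<Rightarrow> complex" where
  "zeta_step f s = 2 powr (s - 1) - (\<Sum>i. zeta_coeff (Suc i) s * f (s + 2 * of_nat (Suc i)))"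

text \<open>Weierstrass test on small discs. The growth bound is available only for real part at
  least 2, but near a given point this covers all but finitely many of the shifted
  arguments.\<close>

lemma zeta_step_holomorphic:
  assumes hol: "f holomorphic_on {s. Re s > c}"
    and bound: "\<And>s. Re s \<ge> 2 \<Longrightarrow> norm (f s) \<le> K * (norm s + 1)"
  shows "zeta_step f holomorphic_on {s. Re s > c - 2}"
proof -
  define T where "T = (\<lambda>i s. zeta_coeff (Suc i) s * f (s + 2 * of_nat (Suc i)))"
  have "(\<lambda>s. \<Sum>i. T i s) holomorphic_on {s. Re s > c - 2}"
  proof (rule holomorphic_uniform_sequence)
    show "open {s. Re s > c - 2}" by (rule open_halfspace_Re_gt)
    have shift: "(\<lambda>s. f (s + 2 * of_nat (Suc i))) holomorphic_on {s. Re s > c - 2}" for i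
    proof -
      have "f \<circ> (\<lambda>s. s + 2 * of_nat (Suc i)) holomorphic_on {s. Re s > c - 2}"
        by (rule holomorphic_on_compose_gen [OF _ hol]) (auto intro!: holomorphic_intros)
      thus ?thesis by (simp add: o_def)
    qed
    have "zeta_coeff i holomorphic_on A" for i A
      unfolding zeta_coeff_def gbinomial_prod_rev
      using norm_odd [of i] by (intro holomorphic_intros) (auto simp del: norm_eq_zero)
    thus "(\<lambda>s. \<Sum>i<n. T i s) holomorphic_on {s. Re s > c - 2}" for n
      unfolding T_def by (intro holomorphic_intros shift)
    fix x :: complex assume "x \<in> {s. Re s > c - 2}"
    then obtain d where d: "d > 0" "cball x d \<subseteq> {s. Re s > c - 2}" "\<And>s. s \<in> cball x d \<Longrightarrow> Re s \<ge> (c - 2) + d"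
      using open_halfplane_cball by blast
    define R where "R = norm x + d"
    have R: "norm s \<le> R" if "s \<in> cball x d" for s
      using that norm_triangle_ineq2 [of s x] by (simp add: R_def dist_norm norm_minus_commute)
    have "norm (f 2) \<le> K * 3" using bound [of 2] by simp
    hence K: "K \<ge> 0" using norm_ge_zero [of "f 2"] by linarith
    have "uniform_limit (cball x d) (\<lambda>n s. \<Sum>i<n. T i s) (\<lambda>s. \<Sum>i. T i s) sequentially"
    proof (rule Weierstrass_m_test_ev)
      show "summable (\<lambda>i. K * ((\<bar>(- (1 + R)) gchoose (2 * Suc i)\<bar> / 4 ^ Suc i) * (R + 1)))"
        by (intro summable_mult summable_mult2,
            subst summable_Suc_iff [of "\<lambda>i. \<bar>(- (1 + R)) gchoose (2 * i)\<bar> / 4 ^ i"])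
           (rule summable_even_gbinomial)
      have "\<forall>s\<in>cball x d. norm (T i s) \<le> K * ((\<bar>(- (1 + R)) gchoose (2 * Suc i)\<bar> / 4 ^ Suc i) * (R + 1))"
        if i: "i \<ge> nat \<lceil>4 - c\<rceil>" for i
      proof
        fix s assume s: "s \<in> cball x d"
        have "real i \<ge> 4 - c" using i by linarith
        hence "Re (s + 2 * of_nat (Suc i)) \<ge> 2" using d(1) d(3) [OF s] by simp
        hence "norm (T i s) \<le> norm (zeta_coeff (Suc i) s) * (K * (norm (s + 2 * of_nat (Suc i)) + 1))"
          unfolding T_def norm_mult by (intro mult_left_mono bound) auto
        also have "\<dots> = K * (norm (zeta_coeff (Suc i) s) * (norm (s + 2 * of_nat (Suc i)) + 1))"
          by (simp only: mult_ac)
        also have "\<dots> \<le> K * ((\<bar>(- (1 + R)) gchoose (2 * Suc i)\<bar> / 4 ^ Suc i) * (R + 1))"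
          by (intro mult_left_mono norm_zeta_coeff_le R s K)
        finally show "norm (T i s) \<le> K * ((\<bar>(- (1 + R)) gchoose (2 * Suc i)\<bar> / 4 ^ Suc i) * (R + 1))" .
      qed
      thus "\<forall>\<^sub>F i in sequentially. \<forall>s\<in>cball x d.
          norm (T i s) \<le> K * ((\<bar>(- (1 + R)) gchoose (2 * Suc i)\<bar> / 4 ^ Suc i) * (R + 1))"
        unfolding eventually_sequentially by blast
    qed
    with d show "\<exists>d>0. cball x d \<subseteq> {s. Re s > c - 2} \<and>
        uniform_limit (cball x d) (\<lambda>n s. \<Sum>i<n. T i s) (\<lambda>s. \<Sum>i. T i s) sequentially"
      by blast
  qed
  thus ?thesis
    unfolding zeta_step_def T_def by (intro holomorphic_intros) auto
qed

text \<open>Stage N represents (s-1) zeta(s) on Re s > 1 - 2N.\<close>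

primrec zeta_approx :: "nat \<Rightarrow> complex \<Rightarrow> complex" where
  "zeta_approx 0 s = (s - 1) * zeta_series s"
| "zeta_approx (Suc N) s = zeta_step (zeta_approx N) s"

text \<open>On Re s > 1 the recurrence says that \<open>zeta_step\<close> reproduces (s-1)
  zeta(s).\<close>

lemma zeta_approx_eq_series:
  assumes "Re s > 1"
  shows "zeta_approx N s = (s - 1) * zeta_series s"
  using assms
proof (induction N arbitrary: s)
  case (Suc N)
  have "(\<lambda>i. zeta_coeff (Suc i) s * ((s + 2 * of_nat (Suc i) - 1) * zeta_series (s + 2 * of_nat (Suc i)))) sums
      (2 powr (s - 1) - zeta_coeff 0 s * ((s + 2 * of_nat 0 - 1) * zeta_series (s + 2 * of_nat 0)))"
    using zeta_series_recurrence [OF Suc.prems]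
    by (subst sums_Suc_iff [of "\<lambda>i. zeta_coeff i s * ((s + 2 * of_nat i - 1) * zeta_series (s + 2 * of_nat i))"]) simp
  moreover have "zeta_approx N (s + 2 * of_nat (Suc i)) =
      (s + 2 * of_nat (Suc i) - 1) * zeta_series (s + 2 * of_nat (Suc i))" for i
    using Suc.prems by (intro Suc.IH) simp
  ultimately show ?case
    by (simp add: zeta_step_def sums_iff zeta_coeff_def)
qed simp

lemma zeta_approx_holomorphic: "zeta_approx N holomorphic_on {s. Re s > 1 - 2 * real N}"
proof (induction N)
  case 0
  have "(\<lambda>s. (s - 1) * zeta_series s) holomorphic_on {s. Re s > 1}"
    by (intro holomorphic_intros zeta_series_holomorphic)
  thus ?case by simp
next
  case (Suc N)
  \<comment> \<open>For the growth bound: on Re s \<ge> 2 every stage is still (s-1) times the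
    series, and the series is bounded there by zeta(2).\<close>
  define K where "K = (\<Sum>m. real (Suc m) powr (- 2))"
  have "norm (zeta_approx N s) \<le> K * (norm s + 1)" if "Re s \<ge> 2" for s
  proof -
    have "norm (zeta_approx N s) = norm (s - 1) * norm (zeta_series s)"
      using that by (simp add: zeta_approx_eq_series norm_mult)
    also have "\<dots> \<le> (norm s + 1) * K"
      unfolding K_def
      using norm_zeta_series_le [OF that] norm_triangle_ineq4 [of s 1] by (intro mult_mono) auto
    finally show ?thesis by (simp add: mult.commute)
  qed
  hence "zeta_step (zeta_approx N) holomorphic_on {s. Re s > (1 - 2 * real N) - 2}"
    by (rule zeta_step_holomorphic [OF Suc])
  thus ?case by (simp add: algebra_simps)
qed

text \<open>The chosen stage N satisfies Re s > 1 - 2N; any other stage whose half-plane contains s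
  gives the same value.\<close>

definition zeta_entire :: "complex \<Rightarrow> complex" where
  "zeta_entire s = zeta_approx (nat \<lceil>2 - Re s\<rceil>) s"

text \<open>Identity theorem: both stages agree on Re s > 1 and are holomorphic on the smaller
  half-plane, that of N.\<close>

lemma zeta_approx_unique:
  assumes "N \<le> N'" "Re s > 1 - 2 * real N"
  shows "zeta_approx N s = zeta_approx N' s"
proof (rule analytic_continuation_open
    [where f = "zeta_approx N" and s = "{s. Re s > 1}" and s' = "{s. Re s > 1 - 2 * real N}"])
  show "open {s. Re s > 1}" "open {s. Re s > 1 - 2 * real N}" by (rule open_halfspace_Re_gt)+
  show "connected {s. Re s > 1 - 2 * real N}"
    by (rule convex_connected) (rule convex_halfspace_Re_gt)
  have "2 \<in> {s. Re s > 1}" by simp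
  thus "{s. Re s > 1} \<noteq> {}" by blast
  show "zeta_approx N' holomorphic_on {s. Re s > 1 - 2 * real N}"
    by (rule holomorphic_on_subset [OF zeta_approx_holomorphic]) (use assms(1) in auto)
qed (use assms zeta_approx_holomorphic in \<open>auto simp: zeta_approx_eq_series\<close>)

lemma zeta_entire_eq_approx:
  assumes "Re s > 1 - 2 * real N"
  shows "zeta_entire s = zeta_approx N s"
proof -
  define N' where "N' = nat \<lceil>2 - Re s\<rceil>"
  have "Re s > 1 - 2 * real N'" unfolding N'_def by linarith
  with assms have "zeta_approx N' s = zeta_approx N s"
    using zeta_approx_unique [of N N' s] zeta_approx_unique [of N' N s] nat_le_linear [of N N'] by metis
  thus ?thesis by (simp add: zeta_entire_def N'_def)
qed

lemma zeta_entire_holomorphic: "zeta_entire holomorphic_on A"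
proof -
  have "zeta_entire holomorphic_on (\<Union>N. {s. Re s > 1 - 2 * real N})"
  proof (rule holomorphic_on_UN_open)
    fix N
    show "zeta_entire holomorphic_on {s. Re s > 1 - 2 * real N}"
      using zeta_approx_holomorphic [of N] by (rule holomorphic_transform) (simp add: zeta_entire_eq_approx)
  qed (rule open_halfspace_Re_gt)
  moreover have "(\<Union>N. {s. Re s > 1 - 2 * real N}) = UNIV"
  proof safe
    fix s :: complex
    have "Re s > 1 - 2 * real (nat \<lceil>2 - Re s\<rceil>)" by linarith
    thus "s \<in> (\<Union>N. {s. Re s > 1 - 2 * real N})" by blast
  qed simp
  ultimately show ?thesis by (auto intro: holomorphic_on_subset)
qed

lemma zeta_entire_recurrence: "zeta_entire s = zeta_step zeta_entire s"
proof -
  define N where "N = nat \<lceil>2 - Re s\<rceil>"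
  have N: "Re s > 1 - 2 * real N" unfolding N_def by linarith
  hence eq: "zeta_entire s = zeta_step (zeta_approx N) s"
    using zeta_entire_eq_approx [of "Suc N" s] by simp
  have "zeta_approx N (s + 2 * of_nat (Suc i)) = zeta_entire (s + 2 * of_nat (Suc i))" for i
    using N by (subst zeta_entire_eq_approx [of N]) auto
  hence "zeta_step (zeta_approx N) s = zeta_step zeta_entire s"
    unfolding zeta_step_def by simp
  with eq show ?thesis by simp
qed

section \<open>Values at nonpositive even integers\<close>

text \<open>At s = -2k the upper entry 1 - s of the binomial coefficient is the natural number 2k +
  1, so the recurrence becomes a finite sum there.\<close>

lemma zeta_coeff_eq_0:
  assumes "2 * i > 2 * k + 1"
  shows "zeta_coeff i (- 2 * of_nat k) = 0"
proof -
  have "(of_nat (2 * k + 1) gchoose (2 * i) :: complex) = 0"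
    using assms unfolding binomial_gbinomial [symmetric] by simp
  thus ?thesis by (simp add: zeta_coeff_def add.commute)
qed

text \<open>At s = 0 only the term 2^(s-1) survives. Division by s - 1 = -1 will give zeta(0) =
  -1/2.\<close>

lemma zeta_entire_0: "zeta_entire 0 = 1/2"
proof -
  have "zeta_coeff (Suc i) 0 = 0" for i
    using zeta_coeff_eq_0 [of 0 "Suc i"] by simp
  thus ?thesis
    by (subst zeta_entire_recurrence) (simp add: zeta_step_def powr_minus inverse_eq_divide)
qed

text \<open>The trivial zeros, by strong induction. In the recurrence at -2k, arguments below 0
  contribute nothing by induction and arguments above 0 have vanishing coefficient. The one argument
  equal to 0 contributes 4^(-k)/2, which cancels 2^(-2k-1).\<close>

lemma zeta_entire_neg_even:
  assumes "k > 0"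
  shows "zeta_entire (- 2 * of_nat k) = 0"
  using assms
proof (induction k rule: less_induct)
  case (less k)
  define g where "g = (\<lambda>i. zeta_coeff (Suc i) (- 2 * of_nat k) * zeta_entire (- 2 * of_nat k + 2 * of_nat (Suc i)))"
  have "g sums g (k - 1)"
  proof (rule sums_single [of "k - 1" g, THEN sums_cong [THEN iffD1, rotated]])
    fix i
    show "(if i = k - 1 then g i else 0) = g i"
    proof (cases i "k - 1" rule: linorder_cases)
      case lt: less
      have "- 2 * of_nat k + 2 * of_nat (Suc i) = - 2 * (of_nat (k - Suc i) :: complex)"
        using lt by (subst of_nat_diff) (auto simp: algebra_simps)
      hence "zeta_entire (- 2 * of_nat k + 2 * of_nat (Suc i)) = 0"
        using less.IH [of "k - Suc i"] lt by simp
      hence "g i = 0" by (simp only: g_def mult_zero_right)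
      thus ?thesis by auto
    next
      case gt: greater
      hence "zeta_coeff (Suc i) (- 2 * of_nat k) = 0" by (intro zeta_coeff_eq_0) simp
      hence "g i = 0" by (simp only: g_def mult_zero_left)
      thus ?thesis by auto
    qed simp
  qed
  moreover have "g (k - 1) = 1 / (2 * 4 ^ k)"
  proof -
    have k: "Suc (k - 1) = k" using less.prems by simp
    have "(of_nat (2 * k + 1) gchoose (2 * k) :: complex) = of_nat (2 * k + 1)"
      unfolding binomial_gbinomial [symmetric] by simp
    hence "zeta_coeff k (- 2 * of_nat k) = of_nat (2 * k + 1) / (4 ^ k * of_nat (2 * k + 1))"
      by (simp add: zeta_coeff_def add.commute)
    also have "\<dots> = 1 / 4 ^ k" by (simp del: of_nat_add of_nat_mult of_nat_Suc)
    finally show ?thesis unfolding g_def k by (simp add: zeta_entire_0)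
  qed
  ultimately have "zeta_entire (- 2 * of_nat k) = 2 powr (- 2 * of_nat k - 1) - 1 / (2 * 4 ^ k)"
    by (subst zeta_entire_recurrence) (simp add: zeta_step_def g_def sums_iff)
  also have "2 powr (- 2 * of_nat k - 1 :: complex) = 2 powr (- of_nat (2 * k + 1))"
    by (rule arg_cong [of _ _ "\<lambda>s. 2 powr s"]) simp
  also have "\<dots> = 1 / (2 * 4 ^ k)"
    unfolding powr_minus by (subst powr_nat') (simp_all add: power_mult inverse_eq_divide)
  finally show ?case by simp
qed

section \<open>Identification with \<open>riemann_zeta\<close>\<close>

text \<open>\<open>zeta_entire\<close> divided by s - 1 witnesses that the choice defining
  \<open>riemann_zeta\<close> is not vacuous.\<close>

lemma riemann_zeta_spec:
  "riemann_zeta holomorphic_on (- {1})"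
  "Re s > 1 \<Longrightarrow> (\<lambda>m. of_nat (Suc m) powr (- s)) sums riemann_zeta s"
proof -
  define P where "P = (\<lambda>f. f holomorphic_on (- {1}) \<and>
     (\<forall>s. Re s > 1 \<longrightarrow> (\<lambda>m. of_nat (Suc m) powr (- s)) sums f s))"
  have "P (\<lambda>s. zeta_entire s / (s - 1))"
    unfolding P_def
  proof (intro conjI allI impI)
    show "(\<lambda>s. zeta_entire s / (s - 1)) holomorphic_on (- {1})"
      by (intro holomorphic_intros zeta_entire_holomorphic) auto
    fix s :: complex assume s: "Re s > 1"
    hence "s \<noteq> 1" by auto
    hence "zeta_entire s / (s - 1) = zeta_series s"
      using s zeta_entire_eq_approx [of 0 s] by simp
    thus "(\<lambda>m. of_nat (Suc m) powr (- s)) sums (zeta_entire s / (s - 1))"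
      using zeta_series_sums [OF s] by simp
  qed
  hence "P (SOME f. P f)" by (rule someI [of P])
  hence "P riemann_zeta" unfolding riemann_zeta_def P_def .
  thus "riemann_zeta holomorphic_on (- {1})"
    "Re s > 1 \<Longrightarrow> (\<lambda>m. of_nat (Suc m) powr (- s)) sums riemann_zeta s"
    unfolding P_def by auto
qed

lemma riemann_zeta_conv_entire:
  assumes "s \<noteq> 1"
  shows "riemann_zeta s = zeta_entire s / (s - 1)"
proof (rule analytic_continuation_open
    [where f = riemann_zeta and g = "\<lambda>s. zeta_entire s / (s - 1)" and s = "{s. Re s > 1}" and s' = "- {1}"])
  show "open {s. Re s > 1}" by (rule open_halfspace_Re_gt)
  show "open (- {1 :: complex})" by auto
  show "connected (- {1 :: complex})" by (rule connected_punctured_universe) simp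
  have "2 \<in> {s. Re s > 1}" by simp
  thus "{s. Re s > 1} \<noteq> {}" by blast
  show "riemann_zeta holomorphic_on (- {1})" by (rule riemann_zeta_spec)
  show "(\<lambda>s. zeta_entire s / (s - 1)) holomorphic_on (- {1})"
    by (intro holomorphic_intros zeta_entire_holomorphic) auto
  fix s assume "s \<in> {s. Re s > 1}"
  hence s: "Re s > 1" by simp
  hence "s \<noteq> 1" by auto
  thus "riemann_zeta s = zeta_entire s / (s - 1)"
    using s zeta_entire_eq_approx [of 0 s] sums_unique2 [OF riemann_zeta_spec(2) [OF s] zeta_series_sums [OF s]]
    by simp
qed (use assms in auto)

lemma riemann_zeta_even: "riemann_zeta (2 * of_nat k) = even_zeta k"
proof (cases "k = 0")
  case True
  thus ?thesis by (simp add: riemann_zeta_conv_entire zeta_entire_0)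
next
  case False
  have "of_nat (Suc m) powr (- (2 * of_nat k)) = 1 / (of_nat (Suc m) ^ (2 * k) :: complex)" for m
  proof -
    have "of_nat (Suc m) powr (2 * of_nat k) = (of_nat (Suc m) ^ (2 * k) :: complex)"
      using powr_nat' [of "of_nat (Suc m)" "2 * k"] by (simp del: of_nat_Suc)
    thus ?thesis by (simp add: powr_minus inverse_eq_divide del: of_nat_Suc)
  qed
  moreover have "Re (2 * of_nat k) > 1" using False by simp
  ultimately show ?thesis
    using riemann_zeta_spec(2) [of "2 * of_nat k"] even_zeta_sums [of k] False sums_unique2 by simp
qed

text \<open>For k > n the argument is a trivial zero. This lets sums over k run past n, as the range
  in the theorem may do.\<close>

lemma riemann_zeta_even_diff:
  "riemann_zeta (2 * of_nat n - 2 * of_nat k) = (if k \<le> n then even_zeta (n - k) else 0)"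
proof (cases "k \<le> n")
  case True
  thus ?thesis
    using riemann_zeta_even [of "n - k"] by (simp add: of_nat_diff right_diff_distrib)
next
  case False
  have eq: "2 * of_nat n - 2 * of_nat k = - 2 * (of_nat (k - n) :: complex)"
    using False by (simp add: of_nat_diff algebra_simps)
  have "- 2 * of_nat (k - n) \<noteq> (1 :: complex)"
  proof
    assume "- 2 * of_nat (k - n) = (1 :: complex)"
    hence "Re (- 2 * of_nat (k - n)) = 1" by simp
    thus False by simp
  qed
  thus ?thesis
    using False zeta_entire_neg_even [of "k - n"] unfolding eq by (simp add: riemann_zeta_conv_entire)
qed

section \<open>Power-weighted convolutions of even zeta values\<close>

lemma sum_atMost_split_ends:
  fixes f :: "nat \<Rightarrow> 'a :: comm_monoid_add"
  assumes "n > 0"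
  shows "(\<Sum>k\<le>n. f k) = f 0 + (f n + (\<Sum>k=1..n-1. f k))"
proof -
  have "{..n} = insert 0 (insert n {1..n-1})" using assms by auto
  moreover have "0 \<notin> insert n {1..n-1}" "n \<notin> {1..n-1}" using assms by auto
  ultimately show ?thesis by simp
qed

text \<open>The terms k = 0, k = n and l = 0 all carry -zeta(2n)/2. Collected, they have the factor
  (1-a)(1+a^(2n)) - (a^(2n)-a) = 1 - a^(2n+1), a multiple of 1 - a with a geometric sum as quotient.
  Cancelling 1 - a leaves polynomials in a on both sides.\<close>

lemma even_zeta_convolution_divided:
  fixes a :: complex and n :: nat
  assumes a: "norm a \<le> 1" "norm (1 - a) \<le> 1" "a \<noteq> 0" "a \<noteq> 1" and n: "n \<ge> 2"
  shows "(\<Sum>k=1..n-1. even_zeta k * even_zeta (n - k) * a ^ (2*k)) =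
           even_zeta n / 2 * (\<Sum>p\<le>2*n. a ^ p)
           + (\<Sum>l=1..n. even_zeta l * even_zeta (n - l) * ((1 - a) ^ (2*l-1) * (a ^ (2*(n-l)) - a)))"
proof -
  define Z where "Z = (\<lambda>k. even_zeta k * even_zeta (n - k))"
  define X where "X = (\<Sum>k=1..n-1. Z k * a ^ (2*k))"
  define Y where "Y = (\<Sum>l=1..n. Z l * ((1 - a) ^ (2*l-1) * (a ^ (2*(n-l)) - a)))"
  define S where "S = (\<Sum>p\<le>2*n. a ^ p)"
  define e where "e = even_zeta n / 2"
  have atMost: "{..n} = insert 0 {1..n}" by auto
  have Z: "Z 0 = - even_zeta n / 2" "Z n = - even_zeta n / 2"
    by (simp_all add: Z_def)
  have "(\<Sum>k\<le>n. a ^ (2*k) * even_zeta k * even_zeta (n - k)) = (\<Sum>k\<le>n. Z k * a ^ (2*k))"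
    by (simp add: Z_def mult_ac)
  also have "\<dots> = X - even_zeta n / 2 * (1 + a ^ (2*n))"
    using n by (subst sum_atMost_split_ends) (simp_all add: X_def Z algebra_simps add_divide_distrib)
  finally have 1: "(\<Sum>k\<le>n. a ^ (2*k) * even_zeta k * even_zeta (n - k)) = X - even_zeta n / 2 * (1 + a ^ (2*n))" .
  have "(\<Sum>l\<le>n. (1 - a) ^ (2*l) * even_zeta l * ((a ^ (2*(n-l)) - a) * even_zeta (n - l))) =
     (\<Sum>l\<le>n. Z l * ((1 - a) ^ (2*l) * (a ^ (2*(n-l)) - a)))"
    by (simp add: Z_def mult_ac)
  also have "\<dots> = Z 0 * (a ^ (2*n) - a) + (\<Sum>l=1..n. Z l * ((1 - a) ^ (2*l) * (a ^ (2*(n-l)) - a)))"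
    unfolding atMost by (subst sum.insert) auto
  also have "(\<Sum>l=1..n. Z l * ((1 - a) ^ (2*l) * (a ^ (2*(n-l)) - a))) = (1 - a) * Y"
    unfolding Y_def sum_distrib_left
  proof (intro sum.cong refl)
    fix l assume "l \<in> {1..n}"
    hence "(1 - a) ^ (2*l) = (1 - a) * (1 - a) ^ (2*l-1)"
      by (cases l) auto
    thus "Z l * ((1 - a) ^ (2*l) * (a ^ (2*(n-l)) - a)) =
        (1 - a) * (Z l * ((1 - a) ^ (2*l-1) * (a ^ (2*(n-l)) - a)))"
      by simp
  qed
  finally have 2: "(\<Sum>l\<le>n. (1 - a) ^ (2*l) * even_zeta l * ((a ^ (2*(n-l)) - a) * even_zeta (n - l))) =
      (1 - a) * Y - even_zeta n / 2 * (a ^ (2*n) - a)"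
    by (simp add: Z)
  have S: "(1 - a) * S = 1 - a ^ (2*n+1)"
    unfolding S_def using sum_gp_basic [of a "2*n"] by simp
  have "(1 - a) * (X - even_zeta n / 2 * (1 + a ^ (2*n))) = (1 - a) * Y - even_zeta n / 2 * (a ^ (2*n) - a)"
    using even_zeta_convolution [OF a, of n] n unfolding 1 2 by simp
  hence "(1 - a) * X = even_zeta n / 2 * ((1 - a) * (1 + a ^ (2*n)) - (a ^ (2*n) - a)) + (1 - a) * Y"
    unfolding e_def [symmetric] by (simp add: algebra_simps)
  also have "(1 - a) * (1 + a ^ (2*n)) - (a ^ (2*n) - a) = (1 - a) * S"
    unfolding S by (simp add: algebra_simps)
  finally have "(1 - a) * X = (1 - a) * (even_zeta n / 2 * S + Y)"
    unfolding e_def [symmetric] by (simp add: algebra_simps)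
  hence "X = even_zeta n / 2 * S + Y"
    using a(4) by simp
  thus ?thesis unfolding X_def Y_def S_def Z_def .
qed

lemma poly_eq_if_eq_on_infinite:
  fixes p q :: "'a :: idom poly"
  assumes "infinite A" "\<And>x. x \<in> A \<Longrightarrow> poly p x = poly q x"
  shows "p = q"
proof (rule ccontr)
  assume "p \<noteq> q"
  hence "finite {x. poly (p - q) x = 0}" by (intro poly_roots_finite) simp
  moreover have "A \<subseteq> {x. poly (p - q) x = 0}" using assms(2) by auto
  ultimately show False using assms(1) finite_subset by blast
qed

text \<open>The linear functional a^p \<mapsto> \<open>w p\<close>, cut off above N. It is used with
  N = 2n, which no occurring exponent exceeds.\<close>

definition weighted_coeff_sum :: "nat \<Rightarrow> (nat \<Rightarrow> complex) \<Rightarrow> complex poly \<Rightarrow> complex" where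
  "weighted_coeff_sum N w p = (\<Sum>k\<le>N. coeff p k * w k)"

lemma weighted_coeff_sum_add:
  "weighted_coeff_sum N w (p + q) = weighted_coeff_sum N w p + weighted_coeff_sum N w q"
  by (simp add: weighted_coeff_sum_def algebra_simps sum.distrib)

lemma weighted_coeff_sum_diff:
  "weighted_coeff_sum N w (p - q) = weighted_coeff_sum N w p - weighted_coeff_sum N w q"
  by (simp add: weighted_coeff_sum_def algebra_simps sum_subtractf)

lemma weighted_coeff_sum_sum:
  "weighted_coeff_sum N w (\<Sum>x\<in>A. f x) = (\<Sum>x\<in>A. weighted_coeff_sum N w (f x))"
  unfolding weighted_coeff_sum_def coeff_sum sum_distrib_right by (rule sum.swap)

lemma weighted_coeff_sum_monom:
  "m \<le> N \<Longrightarrow> weighted_coeff_sum N w (monom c m) = c * w m"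
  by (simp add: weighted_coeff_sum_def if_distrib [of "\<lambda>x. x * _"] cong: if_cong)

text \<open>The divided identity holds for all real a strictly between 0 and 1, hence as an identity
  of polynomials, and any functional a^p \<mapsto> \<open>w p\<close> may be applied to it after
  expanding (1-a)^(2l-1).\<close>

lemma even_zeta_convolution_coeffs:
  fixes w :: "nat \<Rightarrow> complex" and n :: nat
  assumes n: "n \<ge> 2"
  shows "(\<Sum>k=1..n-1. even_zeta k * even_zeta (n - k) * w (2*k)) =
           (\<Sum>p\<le>2*n. even_zeta n / 2 * w p)
           + (\<Sum>l=1..n. \<Sum>s\<le>2*l-1. even_zeta l * even_zeta (n - l) * ((-1) ^ s * of_nat ((2*l-1) choose s))
                * (w (s + 2*(n-l)) - w (s + 1)))"
proof -
  define Z where "Z = (\<lambda>k. even_zeta k * even_zeta (n - k))"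
  define P Q where "P = (\<Sum>k=1..n-1. monom (Z k) (2*k))" and
    "Q = (\<Sum>p\<le>2*n. monom (even_zeta n / 2) p) +
      (\<Sum>l=1..n. \<Sum>s\<le>2*l-1. monom (Z l * ((-1) ^ s * of_nat ((2*l-1) choose s))) (s + 2*(n-l)) -
         monom (Z l * ((-1) ^ s * of_nat ((2*l-1) choose s))) (s + 1))"
  have "P = Q"
  proof (rule poly_eq_if_eq_on_infinite)
    show "infinite (complex_of_real ` {0<..<1})"
      by (subst finite_image_iff) (auto simp: inj_on_def infinite_Ioo)
    fix a assume "a \<in> complex_of_real ` {0<..<1}"
    then obtain t where t: "a = of_real t" "0 < t" "t < 1" by auto
    have "1 - a = of_real (1 - t)" by (simp add: t)
    hence "norm (1 - a) \<le> 1" using t by (simp only: norm_of_real)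
    moreover have "norm a \<le> 1" "a \<noteq> 0" "a \<noteq> 1" using t by auto
    ultimately have eq: "(\<Sum>k=1..n-1. Z k * a ^ (2*k)) = even_zeta n / 2 * (\<Sum>p\<le>2*n. a ^ p)
           + (\<Sum>l=1..n. Z l * ((1 - a) ^ (2*l-1) * (a ^ (2*(n-l)) - a)))"
      unfolding Z_def using n by (intro even_zeta_convolution_divided)
    have "(\<Sum>s\<le>m. x * ((-1) ^ s * of_nat (m choose s)) * a ^ (s + q) - x * ((-1) ^ s * of_nat (m choose s)) * a ^ (s + 1)) =
        x * ((1 - a) ^ m * (a ^ q - a))" for x m q
    proof -
      have "(1 - a) ^ m = (- a + 1) ^ m" by simp
      also have "\<dots> = (\<Sum>s\<le>m. of_nat (m choose s) * (- a) ^ s)"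
        by (subst binomial_ring) simp
      also have "\<dots> = (\<Sum>s\<le>m. (-1) ^ s * of_nat (m choose s) * a ^ s)"
        by (simp add: power_minus [of a] mult_ac)
      finally show ?thesis
        by (simp add: sum_distrib_left sum_distrib_right power_add algebra_simps)
    qed
    hence "poly Q a = even_zeta n / 2 * (\<Sum>p\<le>2*n. a ^ p)
           + (\<Sum>l=1..n. Z l * ((1 - a) ^ (2*l-1) * (a ^ (2*(n-l)) - a)))"
      by (simp only: Q_def poly_add poly_diff poly_sum poly_monom sum_distrib_left)
    with eq show "poly P a = poly Q a"
      by (simp add: P_def poly_sum poly_monom)
  qed
  hence "weighted_coeff_sum (2*n) w P = weighted_coeff_sum (2*n) w Q" by simp
  also have "weighted_coeff_sum (2*n) w P = (\<Sum>k=1..n-1. Z k * w (2*k))"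
    unfolding P_def weighted_coeff_sum_sum
    by (intro sum.cong refl weighted_coeff_sum_monom) auto
  also have "weighted_coeff_sum (2*n) w Q = (\<Sum>p\<le>2*n. even_zeta n / 2 * w p) +
      (\<Sum>l=1..n. \<Sum>s\<le>2*l-1. Z l * ((-1) ^ s * of_nat ((2*l-1) choose s)) * w (s + 2*(n-l)) -
         Z l * ((-1) ^ s * of_nat ((2*l-1) choose s)) * w (s + 1))"
    unfolding Q_def weighted_coeff_sum_sum weighted_coeff_sum_add weighted_coeff_sum_diff
    by (intro arg_cong2 [of _ _ _ _ "(+)"] arg_cong2 [of _ _ _ _ "(-)"] sum.cong refl weighted_coeff_sum_monom) auto
  finally show ?thesis
    unfolding Z_def right_diff_distrib .
qed

lemma sum_add_alternating_sum:
  fixes f :: "nat \<Rightarrow> 'a :: comm_ring_1"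
  shows "(\<Sum>p\<le>2*n. f p) + (\<Sum>p\<le>2*n. (-1) ^ p * f p) = 2 * (\<Sum>k\<le>n. f (2*k))"
  by (induction n) (auto simp: algebra_simps)

text \<open>Take \<open>w p\<close> = (p/2)^i ((2n-p)/2)^j, so that \<open>w (2*k)\<close> = k^i
  (n-k)^j. The sum of all \<open>w p\<close> is twice the sum over even p minus the alternating sum,
  so zeta(2n)/2 times it yields the subtracted zeta(2n) terms up to a polynomial in n. The cutoff M
  is free because monomials of different degrees must later share one range.\<close>

lemma even_zeta_power_sum:
  fixes i j :: nat
  shows "\<exists>c :: nat \<Rightarrow> rat poly. (\<forall>l. degree (c l) \<le> max i j) \<and>
    (\<forall>n M. n \<ge> 2 \<longrightarrow> i + j < 2 * (M + 1) \<longrightarrow>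
      (\<Sum>k=1..n-1. of_rat (of_nat k ^ i * (of_nat n - of_nat k) ^ j) * (even_zeta k * even_zeta (n - k) - even_zeta n)) =
      (\<Sum>l=0..M. of_rat (poly (c l) (of_nat n)) *
         (riemann_zeta (2 * of_nat l) * riemann_zeta (2 * of_nat n - 2 * of_nat l))))"
proof -
  obtain A :: "rat poly" where A: "degree A \<le> max i j"
    "\<And>n. (\<Sum>k\<le>2*n. (-1) ^ k * (of_nat k ^ i * of_nat (2*n-k) ^ j)) = poly A (of_nat n)"
    using alternating_power_sum_poly by blast
  \<comment> \<open>For l = 0: the end terms k = 0 and k = n, present only when an exponent is 0,
    and the alternating sum \<open>A\<close>. The factor -2 compensates zeta(0) = -1/2 in zeta(0)
    zeta(2n).\<close>
  define c where "c = (\<lambda>l. if l = 0 then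
     smult (-2) (smult (0 ^ i) (monom 1 j) + smult (0 ^ j) (monom 1 i) - smult (1 / 2 ^ (i + j + 1)) A)
     else moment_poly i j l)"
  have "degree (c l) \<le> max i j" for l
  proof (cases "l = 0")
    case True
    have "degree (smult (0 ^ i) (monom 1 j) + smult (0 ^ j) (monom 1 i) - smult (1 / 2 ^ (i + j + 1)) A :: rat poly) \<le> max i j"
      using A(1) by (intro degree_diff_le degree_add_le order.trans [OF degree_smult_le])
        (auto intro: order.trans [OF degree_monom_le])
    thus ?thesis using True by (simp add: c_def)
  qed (simp add: c_def degree_moment_poly)
  moreover have "(\<Sum>k=1..n-1. of_rat (of_nat k ^ i * (of_nat n - of_nat k) ^ j) * (even_zeta k * even_zeta (n - k) - even_zeta n)) =
      (\<Sum>l=0..M. of_rat (poly (c l) (of_nat n)) *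
         (riemann_zeta (2 * of_nat l) * riemann_zeta (2 * of_nat n - 2 * of_nat l)))"
    if n: "n \<ge> 2" and M: "i + j < 2 * (M + 1)" for n M
  proof -
    define W :: "nat \<Rightarrow> rat" where "W = (\<lambda>p. (of_nat p / 2) ^ i * ((2 * of_nat n - of_nat p) / 2) ^ j)"
    define w :: "nat \<Rightarrow> complex" where "w = (\<lambda>p. of_rat (W p))"
    define m where "m = (\<lambda>l. of_rat (poly (moment_poly i j l) (of_nat n)) :: complex)"
    have W_even: "W (2*k) = of_nat k ^ i * (of_nat n - of_nat k) ^ j" for k
    proof -
      have "of_nat (2*k) / 2 = (of_nat k :: rat)" "(2 * of_nat n - of_nat (2*k)) / 2 = (of_nat n - of_nat k :: rat)"
        by simp_all
      thus ?thesis by (simp only: W_def)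
    qed
    have moment: "(\<Sum>s\<le>2*l-1. even_zeta l * even_zeta (n - l) * ((-1) ^ s * of_nat ((2*l-1) choose s))
                * (w (s + 2*(n-l)) - w (s + 1))) = m l * (even_zeta l * even_zeta (n - l))" if "l \<le> n" for l
    proof -
      have "W (s + 2*(n-l)) = ((of_nat s + 2 * of_nat n - 2 * of_nat l) / 2) ^ i * ((2 * of_nat l - of_nat s) / 2) ^ j" for s
        using that by (simp add: W_def of_nat_diff algebra_simps)
      moreover have "W (s + 1) = ((of_nat s + 1) / 2) ^ i * ((2 * of_nat n - of_nat s - 1) / 2) ^ j" for s
        by (simp add: W_def algebra_simps)
      ultimately have "m l = of_rat (\<Sum>s\<le>2*l-1. ((-1) ^ s * of_nat ((2*l-1) choose s)) * (W (s + 2*(n-l)) - W (s + 1)))"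
        unfolding m_def poly_moment_poly by simp
      also have "\<dots> = (\<Sum>s\<le>2*l-1. ((-1) ^ s * of_nat ((2*l-1) choose s)) * (w (s + 2*(n-l)) - w (s + 1)))"
        by (simp add: w_def of_rat_sum of_rat_mult of_rat_diff of_rat_power)
      finally show ?thesis by (simp add: sum_distrib_left mult_ac)
    qed
    have alt: "(\<Sum>p\<le>2*n. (-1) ^ p * W p) = poly A (of_nat n) / 2 ^ (i + j)"
    proof -
      have "(\<Sum>p\<le>2*n. (-1) ^ p * W p) = (\<Sum>p\<le>2*n. (-1) ^ p * (of_nat p ^ i * of_nat (2*n-p) ^ j) / 2 ^ (i + j))"
        by (intro sum.cong refl) (simp add: W_def of_nat_diff power_divide power_add)
      thus ?thesis by (simp only: sum_divide_distrib [symmetric] A(2))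
    qed
    have even_sum: "(\<Sum>k\<le>n. W (2*k)) = (\<Sum>k=1..n-1. W (2*k)) + 0 ^ i * of_nat n ^ j + 0 ^ j * of_nat n ^ i"
    proof -
      have "(\<Sum>k\<le>n. W (2*k)) = W (2*0) + (W (2*n) + (\<Sum>k=1..n-1. W (2*k)))"
        using n by (intro sum_atMost_split_ends) simp
      thus ?thesis unfolding W_even [of 0] W_even [of n] by simp
    qed
    have "(\<Sum>p\<le>2*n. W p) = 2 * (\<Sum>k=1..n-1. W (2*k)) + 2 * (0 ^ i * of_nat n ^ j + 0 ^ j * of_nat n ^ i)
         - poly A (of_nat n) / 2 ^ (i + j)"
      using sum_add_alternating_sum [of W n] unfolding alt even_sum by (simp add: algebra_simps)
    also have "\<dots> = 2 * (\<Sum>k=1..n-1. W (2*k)) - poly (c 0) (of_nat n)"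
      by (simp add: c_def poly_monom algebra_simps)
    finally have sum_w: "(\<Sum>p\<le>2*n. w p) = 2 * (\<Sum>k=1..n-1. w (2*k)) - of_rat (poly (c 0) (of_nat n))"
      unfolding w_def of_rat_sum [symmetric] by (simp add: of_rat_diff of_rat_mult)
    have half: "(\<Sum>p\<le>2*n. even_zeta n / 2 * w p) = 
        (\<Sum>k=1..n-1. w (2*k) * even_zeta n) + of_rat (poly (c 0) (of_nat n)) * (even_zeta 0 * even_zeta n)"
      unfolding sum_distrib_left [symmetric] sum_distrib_right [symmetric] sum_w by (simp add: field_simps)
    define h where "h = (\<lambda>l. m l * (even_zeta l * riemann_zeta (2 * of_nat n - 2 * of_nat l)))"
    have "(\<Sum>l=1..n. m l * (even_zeta l * even_zeta (n - l))) = (\<Sum>l=1..n. h l)"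
      by (intro sum.cong refl) (simp add: h_def riemann_zeta_even_diff)
    \<comment> \<open>Terms with l > n vanish by the trivial zeros; those with l > M vanish because
      then 2l > i + j.\<close>
    also have "\<dots> = (\<Sum>l=1..max n M. h l)"
      by (intro sum.mono_neutral_left) (auto simp: h_def riemann_zeta_even_diff)
    also have "\<dots> = (\<Sum>l=1..M. h l)"
      using M by (intro sum.mono_neutral_right) (auto simp: h_def m_def moment_poly_vanishes)
    finally have tail: "(\<Sum>l=1..n. m l * (even_zeta l * even_zeta (n - l))) = (\<Sum>l=1..M. h l)" .
    have "(\<Sum>k=1..n-1. of_rat (of_nat k ^ i * (of_nat n - of_nat k) ^ j) * (even_zeta k * even_zeta (n - k) - even_zeta n)) =
       (\<Sum>k=1..n-1. even_zeta k * even_zeta (n - k) * w (2*k)) - (\<Sum>k=1..n-1. w (2*k) * even_zeta n)"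
      unfolding sum_subtractf [symmetric] w_def W_even by (simp add: algebra_simps)
    also have "\<dots> = of_rat (poly (c 0) (of_nat n)) * (even_zeta 0 * even_zeta n) + (\<Sum>l=1..n. m l * (even_zeta l * even_zeta (n - l)))"
      unfolding even_zeta_convolution_coeffs [OF n, of w] half using moment by simp
    also have "\<dots> = of_rat (poly (c 0) (of_nat n)) * (even_zeta 0 * even_zeta n) + (\<Sum>l=1..M. h l)"
      unfolding tail ..
    also have "\<dots> = (\<Sum>l=0..M. of_rat (poly (c l) (of_nat n)) *
         (riemann_zeta (2 * of_nat l) * riemann_zeta (2 * of_nat n - 2 * of_nat l)))"
      using riemann_zeta_even_diff [of n 0]
      by (simp add: sum.atLeast_Suc_atMost [of 0 M] h_def m_def c_def riemann_zeta_even)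
    finally show ?thesis .
  qed
  ultimately show ?thesis by blast
qed

section \<open>Double zeta values\<close>

text \<open>Here m = 0 is included: for k > 0 its term is 1/0 = 0.\<close>

lemma even_zeta_has_sum:
  assumes "k > 0"
  shows "((\<lambda>m. 1 / of_nat m ^ (2*k)) has_sum even_zeta k) (UNIV :: nat set)"
    and "(\<lambda>m. norm (1 / of_nat m ^ (2*k) :: complex)) summable_on (UNIV :: nat set)"
proof -
  have s: "summable (\<lambda>m. norm (1 / of_nat m ^ (2*k) :: complex))"
    by (rule summable_Suc_iff [THEN iffD1, OF summable_norm_inverse_power]) (use assms in simp)
  have "(\<lambda>m. 1 / of_nat m ^ (2*k)) sums (even_zeta k + 1 / of_nat 0 ^ (2*k))"
    by (rule sums_Suc_iff [THEN iffD1, OF even_zeta_sums [OF assms]])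
  hence "(\<lambda>m. 1 / of_nat m ^ (2*k)) sums even_zeta k" using assms by (simp add: power_0_left)
  with s show "((\<lambda>m. 1 / of_nat m ^ (2*k)) has_sum even_zeta k) (UNIV :: nat set)"
    by (intro norm_summable_imp_has_sum)
  show "(\<lambda>m. norm (1 / of_nat m ^ (2*k) :: complex)) summable_on (UNIV :: nat set)"
    using s by (subst summable_on_UNIV_nonneg_real_iff) auto
qed

text \<open>Split the absolutely summable double series for zeta(2k) zeta(2l) into m1 > m2, m1 < m2
  and the diagonal, which gives zeta(2k+2l). Pairs with a zero entry contribute 1/0 = 0, so the
  condition m2 > 0 makes no difference to the sums.\<close>

lemma double_zeta_stuffle:
  assumes "k > 0" "l > 0"
  shows "double_zeta (2*k) (2*l) + double_zeta (2*l) (2*k) = even_zeta k * even_zeta l - even_zeta (k + l)"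
proof -
  define f :: "nat \<times> nat \<Rightarrow> complex" where "f = (\<lambda>(m1, m2). 1 / (of_nat m1 ^ (2*k) * of_nat m2 ^ (2*l)))"
  define gt lt diag :: "(nat \<times> nat) set" where "gt = {(m1, m2). m1 > m2}" and "lt = {(m1, m2). m1 < m2}"
    and "diag = (\<lambda>m. (m, m)) ` UNIV"
  have norm_f: "norm (f (m1, m2)) = norm (1 / of_nat m1 ^ (2*k) :: complex) * norm (1 / of_nat m2 ^ (2*l) :: complex)" for m1 m2
    by (simp add: f_def norm_divide norm_mult)
  have "(\<lambda>p. norm (f p)) summable_on (UNIV \<times> UNIV)"
  proof (rule summable_on_SigmaI)
    fix m1 :: nat
    have "((\<lambda>m2. norm (1 / of_nat m2 ^ (2*l) :: complex)) has_sum
        infsum (\<lambda>m2. norm (1 / of_nat m2 ^ (2*l) :: complex)) UNIV) (UNIV :: nat set)"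
      by (intro has_sum_infsum even_zeta_has_sum assms)
    thus "((\<lambda>m2. norm (f (m1, m2))) has_sum norm (1 / of_nat m1 ^ (2*k) :: complex) *
        infsum (\<lambda>m2. norm (1 / of_nat m2 ^ (2*l) :: complex)) UNIV) (UNIV :: nat set)"
      unfolding norm_f by (rule has_sum_cmult_right)
  qed (auto intro!: summable_on_cmult_left even_zeta_has_sum assms)
  hence "f summable_on UNIV"
    using abs_summable_summable [of f "UNIV \<times> UNIV"] by simp
  hence sub: "f summable_on A" for A
    by (rule summable_on_subset_banach) simp
  have "(f has_sum infsum f UNIV) (UNIV \<times> UNIV)"
    using has_sum_infsum [OF \<open>f summable_on UNIV\<close>] by simp
  hence "((\<lambda>m1. 1 / of_nat m1 ^ (2*k) * even_zeta l) has_sum infsum f UNIV) UNIV"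
  proof (rule has_sum_SigmaD)
    fix m1 :: nat
    show "((\<lambda>m2. f (m1, m2)) has_sum 1 / of_nat m1 ^ (2*k) * even_zeta l) UNIV"
      using has_sum_cmult_right [OF even_zeta_has_sum(1) [OF assms(2)], of "1 / of_nat m1 ^ (2*k)"]
      by (simp add: f_def)
  qed
  moreover have "((\<lambda>m1. 1 / of_nat m1 ^ (2*k) * even_zeta l) has_sum even_zeta k * even_zeta l) (UNIV :: nat set)"
    by (intro has_sum_cmult_left even_zeta_has_sum assms)
  ultimately have total: "infsum f UNIV = even_zeta k * even_zeta l"
    using has_sum_unique by blast
  have "(UNIV :: (nat \<times> nat) set) = (gt \<union> lt) \<union> diag"
    by (auto simp: gt_def lt_def diag_def image_def)
  hence "infsum f UNIV = infsum f gt + infsum f lt + infsum f diag"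
    using infsum_Un_disjoint [OF sub sub, of "gt \<union> lt" diag] infsum_Un_disjoint [OF sub sub, of gt lt]
    by (force simp: gt_def lt_def diag_def)
  moreover have "infsum f diag = even_zeta (k + l)"
  proof -
    have "infsum f diag = infsum (\<lambda>m. 1 / of_nat m ^ (2*(k+l))) UNIV"
      unfolding diag_def by (subst infsum_reindex) (auto simp: inj_on_def o_def f_def power_add algebra_simps)
    also have "\<dots> = even_zeta (k + l)"
      using assms by (intro infsumI even_zeta_has_sum) simp
    finally show ?thesis .
  qed
  moreover have "infsum f gt = double_zeta (2*k) (2*l)"
    unfolding double_zeta_def using assms
    by (intro infsum_cong_neutral) (auto simp: f_def gt_def)
  moreover have "infsum f lt = double_zeta (2*l) (2*k)"
  proof -
    have lt: "lt = prod.swap ` {(m1, m2). m1 > m2}" by (auto simp: lt_def)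
    have "infsum f lt = infsum (f \<circ> prod.swap) {(m1, m2). m1 > m2}"
      unfolding lt by (rule infsum_reindex) simp
    also have "\<dots> = double_zeta (2*l) (2*k)"
      unfolding double_zeta_def using assms
      by (intro infsum_cong_neutral) (auto simp: f_def mult.commute)
    finally show ?thesis .
  qed
  ultimately show ?thesis using total by (simp add: algebra_simps)
qed

section \<open>Symmetric polynomials and the final assembly\<close>

lemma symmetric_xy_degree_coeff_le:
  assumes "symmetric_xy F"
  shows "degree (coeff F i) \<le> degree F"
proof (rule degree_le, safe)
  fix j assume "degree F < j"
  hence "coeff (coeff F j) i = 0" by (simp add: coeff_eq_0)
  thus "coeff (coeff F i) j = 0" using assms by (simp add: symmetric_xy_def)
qed

lemma eval_xy_conv_sum:
  assumes "symmetric_xy F"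
  shows "eval_xy F a b = (\<Sum>i\<le>degree F. \<Sum>j\<le>degree F. coeff (coeff F i) j * (a ^ i * b ^ j))"
proof -
  have "eval_xy F a b = (\<Sum>i\<le>degree F. poly (coeff F i) b * a ^ i)"
    by (simp add: eval_xy_def poly_altdef [of F] poly_sum)
  also have "\<dots> = (\<Sum>i\<le>degree F. \<Sum>j\<le>degree F. coeff (coeff F i) j * (a ^ i * b ^ j))"
  proof (intro sum.cong refl)
    fix i
    have "poly (coeff F i) b = (\<Sum>j\<le>degree F. coeff (coeff F i) j * b ^ j)"
      unfolding poly_altdef using symmetric_xy_degree_coeff_le [OF assms, of i]
      by (intro sum.mono_neutral_left) (auto simp: coeff_eq_0)
    thus "poly (coeff F i) b * a ^ i = (\<Sum>j\<le>degree F. coeff (coeff F i) j * (a ^ i * b ^ j))"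
      by (simp add: sum_distrib_left sum_distrib_right mult_ac)
  qed
  finally show ?thesis .
qed

lemma eval_xy_commute:
  assumes "symmetric_xy F"
  shows "eval_xy F a b = eval_xy F b a"
proof -
  have "coeff (coeff F i) j = coeff (coeff F j) i" for i j
    using assms by (simp add: symmetric_xy_def)
  thus ?thesis
    unfolding eval_xy_conv_sum [OF assms] by (subst sum.swap) (simp add: mult_ac)
qed

text \<open>Symmetry bounds both exponents by \<open>degree F\<close>; this gives the finiteness on
  which \<open>Max\<close> relies.\<close>

lemma total_degree_ge:
  assumes "symmetric_xy F" "coeff (coeff F i) j \<noteq> 0"
  shows "i + j \<le> total_degree F"
proof -
  have bound: "i \<le> degree F \<and> j \<le> degree F" if "coeff (coeff F i) j \<noteq> 0" for i j
    using that assms(1) by (metis coeff_0 le_degree symmetric_xy_def)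
  have "{i + j | i j. coeff (coeff F i) j \<noteq> 0} \<subseteq> {..2 * degree F}"
    using bound by fastforce
  hence "finite {i + j | i j. coeff (coeff F i) j \<noteq> 0}"
    using finite_subset by blast
  thus ?thesis
    unfolding total_degree_def using assms(2) by (intro Max_ge) auto
qed

lemma sum_rotate:
  "(\<Sum>k\<in>A. \<Sum>i\<in>B. \<Sum>j\<in>D. g k i j) = (\<Sum>i\<in>B. \<Sum>j\<in>D. \<Sum>k\<in>A. g k i j)"
  by (subst sum.swap) (intro sum.cong refl sum.swap)

theorem theorem3p11:
  fixes F :: "rat poly poly" and r d :: nat
  assumes "symmetric_xy F"
    and "r = total_degree F"
    and "d = degree F"
  shows "\<exists>c :: nat \<Rightarrow> rat poly.
    (\<forall>k \<le> r div 2. degree (c k) \<le> d) \<and>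
    (\<forall>n :: nat. n \<ge> 2 \<longrightarrow>
      (\<Sum>k = 1..n - 1. of_rat (eval_xy F (of_nat k) (of_nat n - of_nat k))
          * double_zeta (2 * k) (2 * n - 2 * k)) =
      (\<Sum>k = 0..r div 2. of_rat (poly (c k) (of_nat n))
          * (riemann_zeta (2 * of_nat k) * riemann_zeta (2 * of_nat n - 2 * of_nat k))))"
proof -
  define f where "f = (\<lambda>i j. coeff (coeff F i) j)"
  define T :: "nat \<Rightarrow> nat \<Rightarrow> nat \<Rightarrow> complex" where
    "T = (\<lambda>i j n. \<Sum>k=1..n-1. of_rat (of_nat k ^ i * (of_nat n - of_nat k) ^ j)
            * (even_zeta k * even_zeta (n - k) - even_zeta n))"
  define Z where "Z = (\<lambda>n k. riemann_zeta (2 * of_nat k) * riemann_zeta (2 * of_nat n - 2 * of_nat k))"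
  have "\<exists>c. (\<forall>l. degree (c l) \<le> max i j) \<and> (\<forall>n M. n \<ge> 2 \<longrightarrow> i + j < 2 * (M + 1) \<longrightarrow>
      T i j n = (\<Sum>l=0..M. of_rat (poly (c l) (of_nat n)) * Z n l))" for i j
    unfolding T_def Z_def by (rule even_zeta_power_sum)
  then obtain C where C: "\<And>i j l. degree (C i j l) \<le> max i j"
    "\<And>i j n M. n \<ge> 2 \<Longrightarrow> i + j < 2 * (M + 1) \<Longrightarrow>
      T i j n = (\<Sum>l=0..M. of_rat (poly (C i j l) (of_nat n)) * Z n l)"
    by metis
  \<comment> \<open>The 1/2 undoes the doubling of the left side below. As i and j stay at most d,
    so does max i j.\<close>
  define c where "c = (\<lambda>l. smult (1/2) (\<Sum>i\<le>d. \<Sum>j\<le>d. smult (f i j) (C i j l)))"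
  have "degree (c l) \<le> d" for l
    unfolding c_def
    by (intro order.trans [OF degree_smult_le] degree_sum_le order.trans [OF C(1)]) auto
  moreover have "(\<Sum>k=1..n-1. of_rat (eval_xy F (of_nat k) (of_nat n - of_nat k)) * double_zeta (2*k) (2*n - 2*k)) =
      (\<Sum>k = 0..r div 2. of_rat (poly (c k) (of_nat n)) * Z n k)" (is "?lhs = ?rhs") if n: "n \<ge> 2" for n
  proof -
    define E :: "nat \<Rightarrow> complex" where "E = (\<lambda>k. of_rat (eval_xy F (of_nat k) (of_nat n - of_nat k)))"
    have E_rev: "E (n - k) = E k" if "k \<le> n" for k
      using that eval_xy_commute [OF assms(1)] by (simp add: E_def of_nat_diff)
    \<comment> \<open>Adding the reversed sum, under which the weight \<open>E\<close> is invariant,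
      pairs each double zeta value with its transpose, as the stuffle relation requires.\<close>
    have "?lhs = (\<Sum>k=1..n-1. E (n - k) * double_zeta (2*(n-k)) (2*n - 2*(n-k)))"
      unfolding E_def using n by (subst sum.atLeastAtMost_rev) simp
    also have "\<dots> = (\<Sum>k=1..n-1. E k * double_zeta (2*(n-k)) (2*k))"
      by (intro sum.cong refl arg_cong2 [of _ _ _ _ "(*)"] E_rev arg_cong2 [of _ _ _ _ double_zeta]) auto
    finally have "2 * ?lhs = (\<Sum>k=1..n-1. E k * (double_zeta (2*k) (2*(n-k)) + double_zeta (2*(n-k)) (2*k)))"
      by (simp add: E_def distrib_left sum.distrib diff_mult_distrib2)
    also have "\<dots> = (\<Sum>k=1..n-1. E k * (even_zeta k * even_zeta (n - k) - even_zeta n))"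
    proof (intro sum.cong refl)
      fix k assume "k \<in> {1..n-1}"
      hence "0 < k" "0 < n - k" "k + (n - k) = n" using n by auto
      thus "E k * (double_zeta (2*k) (2*(n-k)) + double_zeta (2*(n-k)) (2*k)) =
          E k * (even_zeta k * even_zeta (n - k) - even_zeta n)"
        using double_zeta_stuffle [of k "n - k"] by simp
    qed
    also have "\<dots> = (\<Sum>k=1..n-1. \<Sum>i\<le>d. \<Sum>j\<le>d. of_rat (f i j) * (of_rat (of_nat k ^ i * (of_nat n - of_nat k) ^ j)
            * (even_zeta k * even_zeta (n - k) - even_zeta n)))"
      unfolding E_def eval_xy_conv_sum [OF assms(1)] f_def assms(3)
      by (simp only: of_rat_sum of_rat_mult sum_distrib_right mult.assoc)
    also have "\<dots> = (\<Sum>i\<le>d. \<Sum>j\<le>d. of_rat (f i j) * T i j n)"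
      unfolding T_def sum_distrib_left
      by (rule sum_rotate)
    also have "\<dots> = (\<Sum>i\<le>d. \<Sum>j\<le>d. \<Sum>l=0..r div 2. of_rat (f i j * poly (C i j l) (of_nat n)) * Z n l)"
    proof (intro sum.cong refl)
      fix i j
      show "of_rat (f i j) * T i j n = (\<Sum>l=0..r div 2. of_rat (f i j * poly (C i j l) (of_nat n)) * Z n l)"
      \<comment> \<open>A nonzero coefficient forces i + j \<le> r < 2 (r div 2 + 1), so the common
        cutoff M = r div 2 is admissible for every monomial present.\<close>
      proof (cases "f i j = 0")
        case False
        hence "i + j \<le> r"
          using total_degree_ge [OF assms(1)] by (simp add: f_def assms(2))
        hence "i + j < 2 * (r div 2 + 1)" by simp
        thus ?thesis
          by (simp only: C(2) [OF n] sum_distrib_left of_rat_mult mult.assoc)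
      qed simp
    qed
    also have "\<dots> = (\<Sum>l=0..r div 2. \<Sum>i\<le>d. \<Sum>j\<le>d. of_rat (f i j * poly (C i j l) (of_nat n)) * Z n l)"
      by (rule sum_rotate [symmetric])
    also have "\<dots> = 2 * ?rhs"
      by (simp add: c_def poly_sum of_rat_mult of_rat_sum of_rat_divide sum_distrib_left sum_distrib_right mult_ac)
    finally show ?thesis by simp
  qed
  ultimately show ?thesis
    unfolding Z_def by blast
qed

end
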